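(* Assume the setting and all standing assumptions listed in the context (two-time-scale recursion, regularity of $f,g,\lambda$, state-dependent noise with exponents $\delta_{ij}\in[0,1)$). For $x\in(\tfrac12,1]$ let $$m(x)=\min\left\{\frac{(1+\delta_{11})x-\delta_{11}}{1-\delta_{11}},\ \frac{x}{1-\delta_{12}},\ \frac{(2-\delta_{21})(1-x)}{1-\delta_{21}},\ \frac{2(1-x)}{1-\delta_{22}}\right\},$$ and put $b=1$, $a=\operatorname{argmax}_{x\in(1/2,1]}m(x)$, $t=\max_{x\in(1/2,1]}m(x)$. Let the step sizes be $\alpha_k=\dfrac{\alpha}{(k+1+k_0)^a}$ and $\beta_k=\dfrac{\beta}{(k+1+k_0)^b}$, where $\alpha,\beta,k_0>0$ satisfy $$\frac{\alpha}{\beta}\ge\max\left\{\frac{4}{\mu_f}\Big(2L_\lambda L_g+\frac{2}{\mu_g}L_\lambda^2L_g^2(L_\lambda+1)^2\Big),\ 2c,\ \frac{\mu_g}{\mu_f},\ 1\right\},\qquad \beta\ge\frac{2}{\mu_g}(2a+t),$$ $$k_0\ge\max\left\{\alpha^{1/a},\ \Big(\frac{\alpha^2}{\beta}\Big)^{1/(2a-1)},\ \frac{1}{2^{1/t}-1},\ \frac{1}{2^{1/(2a)}-1},\ (6C_{\alpha\beta}\alpha^2)^{1/(2a-1)}\right\},$$ with $$\begin{aligned}C_{\alpha\beta}={}&L_f^2+4L_\lambda^2L_g^2\frac{\beta^2}{\alpha^2}+2L_fL_\lambda L_g\frac{\beta}{\alpha}+\frac{2}{\mu_g}L_f^2L_\lambda^2L_g^2(L_\lambda+1)^2\beta+\frac1cL_g^2(L_\lambda+2)\frac{\beta}{\alpha}\\&+4cL_\lambda^2L_g^2(L_\lambda+1)^2\frac{\beta^3}{\alpha^3}+L_g^2(2L_\lambda^2+L_\lambda+3)\frac{\beta^2}{\alpha^2}.\end{aligned}$$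 For $M>0$ define $$\begin{aligned}C_2(M)={}&2c\alpha\beta\,\Gamma_{11}\Big(\frac1c\frac{\alpha}{\beta}2M\Big)^{\delta_{11}}+2c\alpha\beta\,\Gamma_{12}(2M)^{\delta_{12}}\\&+\frac{\beta^3}{\alpha^2}\Big(c\Big(\frac{2}{\mu_f}L_\lambda^2+\frac{2}{\mu_f}L_f^2L_\lambda^2+2L_\lambda^2\Big)+1\Big)\left[\Gamma_{21}\Big(\frac1c\frac{\alpha}{\beta}2M\Big)^{\delta_{21}}+\Gamma_{22}(2M)^{\delta_{22}}\right].\end{aligned}$$ Then there exists $M>0$ with $$M\ge\max\left\{3k_0^tV_0,\ \frac3aC_2(M)\right\},$$ and for such $M$ one has, for all integers $k\ge0$, $$\mathbb{E}[V_k]\le\frac{M}{(k+k_0)^t}.$$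
   Context: Norms and inner products are Euclidean. Let $f:\mathbb{R}^{d_1}\times\mathbb{R}^{d_2}\to\mathbb{R}^{d_1}$ and $g:\mathbb{R}^{d_1}\times\mathbb{R}^{d_2}\to\mathbb{R}^{d_2}$. Standing assumptions: (i) There is a unique $(x^*,y^* )$ with $f(x^*,y^* )=0$ and $g(x^*,y^* )=0$. (ii) There is a map $\lambda:\mathbb{R}^{d_2}\to\mathbb{R}^{d_1}$ such that, for each $y$, $x=\lambda(y)$ is the unique solution of $f(x,y)=0$, and $\|\lambda(y_1)-\lambda(y_2)\|\le L_\lambda\|y_1-y_2\|$ for all $y_1,y_2$. (iii) $\|f(x_1,y_1)-f(x_2,y_2)\|\le L_f(\|x_1-x_2\|+\|y_1-y_2\|)$ for all arguments, and for some $\mu_f>0$, $\langle x_1-x_2,f(x_1,y)-f(x_2,y)\rangle\ge\mu_f\|x_1-x_2\|^2$ for all $x_1,x_2,y$. (iv) $\|g(x_1,y_1)-g(x_2,y_2)\|\le L_g(\|x_1-x_2\|+\|y_1-y_2\|)$ for all arguments, and for some $\mu_g>0$, $\langle y-y^*,g(\lambda(y),y)\rangle\ge\mu_g\|y-y^*\|^2$ for all $y$. The process starts from deterministic $x_0,y_0$ and is $$x_{k+1}=x_k-\alpha_k[f(x_k,y_k)+\xi_k],\qquad y_{k+1}=y_k-\beta_k[g(x_k,y_k)+\psi_k],\qquad k\ge0,$$ with positive step sizes $\alpha_k,\beta_k$ and random noises $\xi_k\in\mathbb{R}^{d_1}$, $\psi_k\in\mathbb{R}^{d_2}$. Let $\hat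 x_k=x_k-\lambda(y_k)$, $\hat y_k=y_k-y^*$, and let $\mathcal{Q}_k$ be the $\sigma$-algebra generated by $x_0,y_0,\xi_0,\psi_0,\dots,\xi_k,\psi_k$ ($\mathcal{Q}_{-1}$ is generated by $x_0,y_0$). (v) Noise (state-dependent): $\mathbb{E}[\xi_k\mid\mathcal{Q}_{k-1}]=0$, $\mathbb{E}[\psi_k\mid\mathcal{Q}_{k-1}]=0$, and there are constants $\Gamma_{ij}\ge0$ and exponents $\delta_{ij}\in[0,1)$, $i,j\in\{1,2\}$, such that almost surely for all $k\ge0$ $$\mathbb{E}[\|\xi_k\|^2\mid\mathcal{Q}_{k-1}]\le\Gamma_{11}\|\hat x_k\|^{2\delta_{11}}+\Gamma_{12}\|\hat y_k\|^{2\delta_{12}},\qquad \mathbb{E}[\|\psi_k\|^2\mid\mathcal{Q}_{k-1}]\le\Gamma_{21}\|\hat x_k\|^{2\delta_{21}}+\Gamma_{22}\|\hat y_k\|^{2\delta_{22}}$$ (with $0^0=1$). No assumption is made on the correlation between $\xi_k$ and $\psi_k$. Let $c=\dfrac{4L_g^2}{\mu_f\mu_g}$ and define the Lyapunov function $V_k=c\,\dfrac{\beta_k}{\alpha_k}\|\hat x_k\|^2+\|\hat y_k\|^2$. *)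

theory Defs
  imports "HOL-Probability.Probability"
begin

text \<open>Real powers of nonnegative numbers with the convention \<open>0\<^sup>0 = 1\<close>;
  HOL's \<^term>\<open>(powr)\<close> has \<open>0 powr 0 = 0\<close>.\<close>

definition rpow :: "real \<Rightarrow> real \<Rightarrow> real" where
  "rpow x p = (if p = 0 then 1 else x powr p)"

text \<open>The library's conditional expectation is real-valued; vectors are treated componentwise.\<close>

definition vec_cond_exp ::
  "'w measure \<Rightarrow> 'w measure \<Rightarrow> ('w \<Rightarrow> real ^ 'n) \<Rightarrow> 'w \<Rightarrow> real ^ 'n" where
  "vec_cond_exp P F X = (\<lambda>\<omega>. \<chi> i. real_cond_exp P F (\<lambda>w. X w $ i) \<omega>)"

text \<open>The \<open>\<sigma>\<close>-algebra generated by the random vectors \<open>u\<close>, \<open>v\<close> and the noises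
  \<open>\<xi> i\<close>, \<open>\<psi> i\<close> with \<open>i < n\<close>. The index is shifted by one against \<open>\<Q>\<^sub>k\<close> (generated by the
  noises up to and including time \<open>k\<close>): \<open>history \<dots> k\<close> is \<open>\<Q>\<^sub>k\<^sub>-\<^sub>1\<close>.\<close>

definition history ::
  "'w measure \<Rightarrow> ('w \<Rightarrow> real ^ 'd1) \<Rightarrow> ('w \<Rightarrow> real ^ 'd2) \<Rightarrow>
   (nat \<Rightarrow> 'w \<Rightarrow> real ^ 'd1) \<Rightarrow> (nat \<Rightarrow> 'w \<Rightarrow> real ^ 'd2) \<Rightarrow> nat \<Rightarrow> 'w measure" where
  "history P u v \<xi> \<psi> n = sigma (space P)
     ({u -` A \<inter> space P | A. A \<in> sets borel} \<union>
      {v -` A \<inter> space P | A. A \<in> sets borel} \<union>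
      (\<Union>i<n. {\<xi> i -` A \<inter> space P | A. A \<in> sets borel}) \<union>
      (\<Union>i<n. {\<psi> i -` A \<inter> space P | A. A \<in> sets borel}))"

end

theory Submission
  imports Defs
begin

text \<open>Fix a step and write \<open>A\<close>, \<open>B\<close> for the two step sizes, \<open>u\<close> for the norm of \<open>x - lam y\<close> and \<open>v\<close>
for the norm of \<open>y - ys\<close>. Expanding the two recursions turns the Lyapunov function
\<open>c (B/A) u\<^sup>2 + v\<^sup>2\<close> of the next iterate into four kinds of terms: the contraction
\<open>-2 c \<mu>f B u\<^sup>2 - 2 \<mu>g B v\<^sup>2\<close> due to monotonicity; products such as \<open>u v\<close> and \<open>u\<close> times the norm
of \<open>\<psi>\<close>; squares of the noises; and terms that are linear in the noises. Because
\<open>c \<mu>f \<mu>g = 4 Lg\<^sup>2\<close>, Young's inequality pays for all products with three quarters of the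
contraction, and what remains has the factor \<open>1 - \<mu>g B / 2 + C A\<^sup>2\<close> (lemmas \<open>drift_scalar\<close> and
\<open>drift_pointwise\<close>). All this is deterministic. Taking expectations, the terms linear in the
noises vanish, as their coefficients are functions of the current state
(\<open>inner_cond_mean_zero\<close>).

The squared noises have conditional expectations of the order \<open>u\<^sup>2\<^sup>\<delta>\<close> and \<open>v\<^sup>2\<^sup>\<delta>\<close> with \<open>\<delta> < 1\<close>.
By concavity the expectation of \<open>u\<^sup>2\<^sup>\<delta>\<close> is at most \<open>z\<^sup>\<delta>\<close> as soon as that of \<open>u\<^sup>2\<close> is at most \<open>z\<close>
(\<open>second_moment_bound\<close>). This closes an induction on the number of steps: with \<open>K = k + 1 + k0\<close>, the
bound \<open>M / (K - 1)\<^sup>t\<close> for the expected Lyapunov function makes the noise at most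
\<open>C2(M) / K\<^sup>1\<^sup>+\<^sup>t\<close>. That no slower power of \<open>K\<close> appears is exactly what the four members of the
minimum \<open>m\<close> say at \<open>x = a\<close> (\<open>optimal_exponent\<close>); the factor \<open>1 - (2 a + t) / K + 1 / (6 K)\<close> then
leaves room for the noise when \<open>C2(M) \<le> (a/3) M\<close> (\<open>rate_step\<close>). Since all exponents \<open>\<delta>\<close> are below 1,
\<open>C2\<close> grows sublinearly and a suitable \<open>M\<close> exists.\<close>

section \<open>Deterministic one-step drift\<close>

lemma young:
  fixes p q e :: real
  assumes "e > 0"
  shows "2 * p * q \<le> e * p\<^sup>2 + q\<^sup>2 / e"
proof -
  have "0 \<le> (e * p - q)\<^sup>2 / e" using assms by simp
  also have "\<dots> = e * p\<^sup>2 + q\<^sup>2 / e - 2 * p * q"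
    using assms by (simp add: power2_eq_square field_simps)
  finally show ?thesis by simp
qed

text \<open>Here \<open>G\<close> and \<open>s\<close> stand for the norms of the slow drift and of the slow noise, and the left-hand side
is what the expansion of the squared norms yields. The summands of \<open>C\<close> collect the terms of
second order in the step sizes, and those in the coefficient of \<open>s\<^sup>2\<close> the costs of separating \<open>s\<close>
from the state by Young's inequality and of squaring the moves of \<open>y\<close> and \<open>lam y\<close>; \<open>A \<le> 1\<close> and \<open>A\<^sup>2 \<le> B\<close> bring all noise
contributions to the common order \<open>B\<^sup>3 / A\<^sup>2\<close>.\<close>

lemma drift_scalar:
  fixes u v s A B r \<rho> \<beta> c L Lf Lg \<mu>f \<mu>g C G :: real
  assumes pos: "A > 0" "B > 0" "c > 0" "\<mu>f > 0" "\<mu>g > 0"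
    and L0: "L \<ge> 0" "Lf \<ge> 0" "Lg \<ge> 0" and u0: "u \<ge> 0"
    and r: "r = B / A" and c: "c * \<mu>f * \<mu>g = 4 * Lg\<^sup>2"
    and A1: "A \<le> 1" and AB: "A\<^sup>2 \<le> B" and B\<beta>: "B \<le> \<beta>" and r\<rho>: "r \<le> \<rho>"
    and ratio: "r * (4 / \<mu>f * (2 * L * Lg + 2 / \<mu>g * L\<^sup>2 * Lg\<^sup>2 * (L + 1)\<^sup>2)) \<le> 1"
    and rc: "r * (2 * c) \<le> 1" and rmu: "r * \<mu>g \<le> \<mu>f"
    and G: "0 \<le> G" "G \<le> Lg * (u + (L + 1) * v)"
    and C: "C = Lf\<^sup>2 + 4 * L\<^sup>2 * Lg\<^sup>2 * \<rho>\<^sup>2 + 2 * Lf * L * Lg * \<rho>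
        + 2 / \<mu>g * Lf\<^sup>2 * L\<^sup>2 * Lg\<^sup>2 * (L + 1)\<^sup>2 * \<beta>
        + 1 / c * Lg\<^sup>2 * (L + 2) * \<rho>
        + 4 * c * L\<^sup>2 * Lg\<^sup>2 * (L + 1)\<^sup>2 * \<rho> ^ 3
        + Lg\<^sup>2 * (2 * L\<^sup>2 + L + 3) * \<rho>\<^sup>2"
  shows "c * r * ((1 - 2 * A * \<mu>f + A\<^sup>2 * Lf\<^sup>2) * u\<^sup>2 + 2 * L\<^sup>2 * B\<^sup>2 * (G\<^sup>2 + s\<^sup>2)
            + 2 * ((1 + A * Lf) * u) * (L * B * (G + s)))
         + (v\<^sup>2 - 2 * B * (\<mu>g * v\<^sup>2 - Lg * u * v) + B\<^sup>2 * (G\<^sup>2 + s\<^sup>2))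
       \<le> (1 - \<mu>g * B / 2 + C * A\<^sup>2) * (c * r * u\<^sup>2 + v\<^sup>2)
         + B ^ 3 / A\<^sup>2 * (c * (2 / \<mu>f * L\<^sup>2 + 2 / \<mu>f * Lf\<^sup>2 * L\<^sup>2 + 2 * L\<^sup>2) + 1) * s\<^sup>2"
proof -
  have r0: "r > 0" using pos r by simp
  have B: "B = r * A" using r pos by simp
  have \<rho>0: "\<rho> > 0" using r0 r\<rho> by simp
  define w where "w = c * r * u\<^sup>2"
  have w0: "w \<ge> 0" unfolding w_def using pos r0 by simp
  define Q where "Q = L\<^sup>2 * Lg\<^sup>2 * (L + 1)\<^sup>2"
  have Q0: "Q \<ge> 0" unfolding Q_def by simp
  \<comment> \<open>Cross terms. With the budget \<open>2 c \<mu>f B u\<^sup>2\<close> and \<open>2 \<mu>g B v\<^sup>2\<close>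
    coming from monotonicity, \<open>Y1\<close> to \<open>Y5\<close> spend \<open>1/4 + 1/4 + 1/2 + 1/2\<close> of \<open>c \<mu>f B u\<^sup>2\<close> and
    \<open>1 + 1/4 + 1/4\<close> of \<open>\<mu>g B v\<^sup>2\<close>; the remaining halves dominate \<open>\<mu>g B / 2\<close> times the
    Lyapunov function, for the \<open>u\<^sup>2\<close> part by \<open>Y0\<close>.\<close>
  have Y1: "2 * B * (Lg * u * v) \<le> \<mu>g * B * v\<^sup>2 + c * \<mu>f * B * u\<^sup>2 / 4"
  proof -
    have "2 * v * (Lg * u) \<le> \<mu>g * v\<^sup>2 + (Lg * u)\<^sup>2 / \<mu>g" by (rule young[OF pos(5)])
    also have "(Lg * u)\<^sup>2 / \<mu>g = c * \<mu>f / 4 * u\<^sup>2"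
      using c pos by (simp add: power_mult_distrib field_simps)
    finally have "B * (2 * v * (Lg * u)) \<le> B * (\<mu>g * v\<^sup>2 + c * \<mu>f / 4 * u\<^sup>2)"
      using pos by (intro mult_left_mono) auto
    then show ?thesis by (simp add: algebra_simps)
  qed
  have rch: "c * r \<le> 1 / 2" using rc by (simp add: algebra_simps)
  have vh: "c * r * B * ((\<mu>g / 2) * v\<^sup>2) \<le> \<mu>g * B * v\<^sup>2 / 4"
  proof -
    have "(B * \<mu>g / 2 * v\<^sup>2) * (c * r) \<le> (B * \<mu>g / 2 * v\<^sup>2) * (1 / 2)"
      using rch pos by (intro mult_left_mono) auto
    then show ?thesis by (simp add: ac_simps)
  qed
  have Y2: "c * r * (2 * u * (L * B * (Lg * (u + (L + 1) * v)))) \<le> c * \<mu>f * B * u\<^sup>2 / 4 + \<mu>g * B * v\<^sup>2 / 4"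
  proof -
    have "2 * v * (L * Lg * (L + 1) * u) \<le> (\<mu>g / 2) * v\<^sup>2 + (L * Lg * (L + 1) * u)\<^sup>2 / (\<mu>g / 2)"
      using pos by (intro young) simp
    also have "(L * Lg * (L + 1) * u)\<^sup>2 / (\<mu>g / 2) = 2 / \<mu>g * Q * u\<^sup>2"
      unfolding Q_def by (simp add: power_mult_distrib)
    finally have "c * r * B * (2 * v * (L * Lg * (L + 1) * u))
        \<le> c * r * B * ((\<mu>g / 2) * v\<^sup>2 + 2 / \<mu>g * Q * u\<^sup>2)"
      using pos r0 by (intro mult_left_mono) auto
    then have "c * r * (2 * u * (L * B * (Lg * (u + (L + 1) * v))))
        \<le> c * r * B * ((\<mu>g / 2) * v\<^sup>2) + c * B * (r * (2 * L * Lg + 2 / \<mu>g * Q)) * u\<^sup>2"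
      by (simp add: algebra_simps power2_eq_square)
    moreover have "c * B * (r * (2 * L * Lg + 2 / \<mu>g * Q)) * u\<^sup>2 \<le> c * \<mu>f * B * u\<^sup>2 / 4"
    proof -
      have "r * (2 * L * Lg + 2 / \<mu>g * Q) \<le> \<mu>f / 4"
        using ratio pos unfolding Q_def by (simp add: field_simps)
      then have "c * B * u\<^sup>2 * (r * (2 * L * Lg + 2 / \<mu>g * Q)) \<le> c * B * u\<^sup>2 * (\<mu>f / 4)"
        using pos by (intro mult_left_mono) auto
      then show ?thesis by (simp add: ac_simps)
    qed
    ultimately show ?thesis using vh by linarith
  qed
  have Y3: "c * r * (2 * u * (L * B * s)) \<le> c * \<mu>f * B * u\<^sup>2 / 2 + c * (2 / \<mu>f * L\<^sup>2) * (B ^ 3 / A\<^sup>2) * s\<^sup>2"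
  proof -
    have "2 * u * (L * B * s) \<le> (\<mu>f * A / 2) * u\<^sup>2 + (L * B * s)\<^sup>2 / (\<mu>f * A / 2)"
      using pos by (intro young) simp
    then have "c * r * (2 * u * (L * B * s)) \<le> c * r * ((\<mu>f * A / 2) * u\<^sup>2 + (L * B * s)\<^sup>2 / (\<mu>f * A / 2))"
      using pos r0 by (intro mult_left_mono) auto
    also have "\<dots> = c * \<mu>f * B * u\<^sup>2 / 2 + c * (2 / \<mu>f * L\<^sup>2) * (B ^ 3 / A\<^sup>2) * s\<^sup>2"
      unfolding r using pos by (simp add: field_simps power2_eq_square power3_eq_cube)
    finally show ?thesis .
  qed
  have B3: "B ^ 3 \<le> B ^ 3 / A\<^sup>2" "B ^ 3 / A \<le> B ^ 3 / A\<^sup>2"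
    using pos A1 by (auto simp: divide_simps power2_eq_square mult_le_one mult_left_le)
  have Y4: "c * r * (2 * (A * Lf * u) * (L * B * s)) \<le> c * \<mu>f * B * u\<^sup>2 / 2
      + c * (2 / \<mu>f * Lf\<^sup>2 * L\<^sup>2) * (B ^ 3 / A\<^sup>2) * s\<^sup>2"
  proof -
    have "2 * u * (Lf * L * B * s) \<le> (\<mu>f / 2) * u\<^sup>2 + (Lf * L * B * s)\<^sup>2 / (\<mu>f / 2)"
      using pos by (intro young) simp
    then have "c * B * (2 * u * (Lf * L * B * s)) \<le> c * B * ((\<mu>f / 2) * u\<^sup>2 + (Lf * L * B * s)\<^sup>2 / (\<mu>f / 2))"
      using pos by (intro mult_left_mono) auto
    also have "\<dots> = c * \<mu>f * B * u\<^sup>2 / 2 + c * (2 / \<mu>f * Lf\<^sup>2 * L\<^sup>2) * B ^ 3 * s\<^sup>2"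
      using pos by (simp add: field_simps power2_eq_square power3_eq_cube)
    also have "\<dots> \<le> c * \<mu>f * B * u\<^sup>2 / 2 + c * (2 / \<mu>f * Lf\<^sup>2 * L\<^sup>2) * (B ^ 3 / A\<^sup>2) * s\<^sup>2"
      using pos B3 by (intro add_left_mono mult_right_mono mult_left_mono) auto
    finally show ?thesis unfolding B by (simp add: algebra_simps)
  qed
  have Y0: "\<mu>g * B / 2 * w \<le> c * \<mu>f * B * u\<^sup>2 / 2"
  proof -
    have "c * B / 2 * u\<^sup>2 * (r * \<mu>g) \<le> c * B / 2 * u\<^sup>2 * \<mu>f"
      using pos rmu by (intro mult_left_mono) auto
    then show ?thesis unfolding w_def by (simp add: algebra_simps)
  qed
  \<comment> \<open>Second-order terms: beyond the share of \<open>v\<^sup>2\<close> just counted, each is absorbed by summands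
    of \<open>C A\<^sup>2\<close>.\<close>
  have Y5: "c * r * (2 * (A * Lf * u) * (L * B * (Lg * (u + (L + 1) * v))))
     \<le> (2 * Lf * L * Lg * \<rho> + 2 / \<mu>g * Lf\<^sup>2 * Q * \<beta>) * A\<^sup>2 * w + \<mu>g * B * v\<^sup>2 / 4"
  proof -
    have "2 * v * (A * Lf * L * Lg * (L + 1) * u) \<le> (\<mu>g / 2) * v\<^sup>2 + (A * Lf * L * Lg * (L + 1) * u)\<^sup>2 / (\<mu>g / 2)"
      using pos by (intro young) simp
    also have "(A * Lf * L * Lg * (L + 1) * u)\<^sup>2 / (\<mu>g / 2) = 2 / \<mu>g * Lf\<^sup>2 * Q * A\<^sup>2 * u\<^sup>2"
      unfolding Q_def by (simp add: power_mult_distrib)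
    finally have "c * r * B * (2 * v * (A * Lf * L * Lg * (L + 1) * u))
        \<le> c * r * B * ((\<mu>g / 2) * v\<^sup>2 + 2 / \<mu>g * Lf\<^sup>2 * Q * A\<^sup>2 * u\<^sup>2)"
      using pos r0 by (intro mult_left_mono) auto
    then have "c * r * (2 * (A * Lf * u) * (L * B * (Lg * (u + (L + 1) * v))))
        \<le> c * r * B * ((\<mu>g / 2) * v\<^sup>2) + (2 / \<mu>g * Lf\<^sup>2 * Q * A\<^sup>2 * w) * B + (2 * Lf * L * Lg * A\<^sup>2 * w) * r"
      unfolding w_def B by (simp add: algebra_simps power2_eq_square)
    moreover have "(2 / \<mu>g * Lf\<^sup>2 * Q * A\<^sup>2 * w) * B \<le> (2 / \<mu>g * Lf\<^sup>2 * Q * A\<^sup>2 * w) * \<beta>"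
      using pos Q0 w0 B\<beta> by (intro mult_left_mono) auto
    moreover have "(2 * Lf * L * Lg * A\<^sup>2 * w) * r \<le> (2 * Lf * L * Lg * A\<^sup>2 * w) * \<rho>"
      using pos L0 w0 r\<rho> by (intro mult_left_mono) auto
    moreover have "(2 * Lf * L * Lg * \<rho> + 2 / \<mu>g * Lf\<^sup>2 * Q * \<beta>) * A\<^sup>2 * w
      = (2 / \<mu>g * Lf\<^sup>2 * Q * A\<^sup>2 * w) * \<beta> + (2 * Lf * L * Lg * A\<^sup>2 * w) * \<rho>"
      by (simp add: algebra_simps)
    ultimately show ?thesis using vh by linarith
  qed
  have GG: "G\<^sup>2 \<le> (Lg * (u + (L + 1) * v))\<^sup>2" using G by (intro power_mono) auto
  have uv: "2 * u * v \<le> u\<^sup>2 + v\<^sup>2" using sum_squares_bound[of u v] by simp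
  have G1: "G\<^sup>2 \<le> Lg\<^sup>2 * (L + 2) * u\<^sup>2 + Lg\<^sup>2 * (2 * L\<^sup>2 + L + 3) * v\<^sup>2"
  proof -
    have "(Lg * (u + (L + 1) * v))\<^sup>2 = Lg\<^sup>2 * (u\<^sup>2 + (L + 1) * (2 * u * v) + (L + 1)\<^sup>2 * v\<^sup>2)"
      by (simp add: power2_eq_square algebra_simps)
    \<comment> \<open>The square \<open>(L - 1)\<^sup>2\<close> turns \<open>(L + 1) (L + 2)\<close> into the coefficient \<open>2 L\<^sup>2 + L + 3\<close> of \<open>C\<close>.\<close>
    also have "\<dots> \<le> Lg\<^sup>2 * (u\<^sup>2 + (L + 1) * (u\<^sup>2 + v\<^sup>2) + (L + 1)\<^sup>2 * v\<^sup>2 + (L - 1)\<^sup>2 * v\<^sup>2)"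
    proof -
      have "(L + 1) * (2 * u * v) \<le> (L + 1) * (u\<^sup>2 + v\<^sup>2)"
        using uv L0 by (intro mult_left_mono) auto
      moreover have "0 \<le> (L - 1)\<^sup>2 * v\<^sup>2" by simp
      ultimately show ?thesis by (intro mult_left_mono) (linarith, simp)
    qed
    also have "\<dots> = Lg\<^sup>2 * (L + 2) * u\<^sup>2 + Lg\<^sup>2 * (2 * L\<^sup>2 + L + 3) * v\<^sup>2"
      by (simp add: power2_eq_square algebra_simps)
    finally show ?thesis using GG by simp
  qed
  have G2: "G\<^sup>2 \<le> 2 * Lg\<^sup>2 * u\<^sup>2 + 2 * Lg\<^sup>2 * (L + 1)\<^sup>2 * v\<^sup>2"
  proof -
    have "2 * u * ((L + 1) * v) \<le> u\<^sup>2 + ((L + 1) * v)\<^sup>2" using sum_squares_bound by blast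
    then have "(u + (L + 1) * v)\<^sup>2 \<le> 2 * u\<^sup>2 + 2 * ((L + 1) * v)\<^sup>2"
      by (simp add: power2_sum)
    then have "Lg\<^sup>2 * (u + (L + 1) * v)\<^sup>2 \<le> Lg\<^sup>2 * (2 * u\<^sup>2 + 2 * ((L + 1) * v)\<^sup>2)"
      by (intro mult_left_mono) auto
    also have "\<dots> = 2 * Lg\<^sup>2 * u\<^sup>2 + 2 * Lg\<^sup>2 * (L + 1)\<^sup>2 * v\<^sup>2"
      by (simp add: power_mult_distrib distrib_left)
    finally show ?thesis using GG unfolding power_mult_distrib by linarith
  qed
  have r2: "r\<^sup>2 \<le> \<rho>\<^sup>2" "r ^ 3 \<le> \<rho> ^ 3" using r0 r\<rho> by (auto intro: power_mono)
  have Y6: "B\<^sup>2 * G\<^sup>2 \<le> (1 / c * Lg\<^sup>2 * (L + 2) * \<rho>) * A\<^sup>2 * w + (Lg\<^sup>2 * (2 * L\<^sup>2 + L + 3) * \<rho>\<^sup>2) * A\<^sup>2 * v\<^sup>2"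
  proof -
    have "B\<^sup>2 * G\<^sup>2 \<le> B\<^sup>2 * (Lg\<^sup>2 * (L + 2) * u\<^sup>2 + Lg\<^sup>2 * (2 * L\<^sup>2 + L + 3) * v\<^sup>2)"
      using G1 by (intro mult_left_mono) auto
    also have "\<dots> = (1 / c * Lg\<^sup>2 * (L + 2) * A\<^sup>2 * w) * r + (Lg\<^sup>2 * (2 * L\<^sup>2 + L + 3) * A\<^sup>2 * v\<^sup>2) * r\<^sup>2"
      unfolding w_def B using pos by (simp add: field_simps power2_eq_square)
    also have "\<dots> \<le> (1 / c * Lg\<^sup>2 * (L + 2) * A\<^sup>2 * w) * \<rho> + (Lg\<^sup>2 * (2 * L\<^sup>2 + L + 3) * A\<^sup>2 * v\<^sup>2) * \<rho>\<^sup>2"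
      using pos L0 w0 r\<rho> r2 by (intro add_mono mult_left_mono) auto
    finally show ?thesis by (simp add: algebra_simps)
  qed
  have Y7: "c * r * (2 * L\<^sup>2 * B\<^sup>2 * G\<^sup>2) \<le> (4 * L\<^sup>2 * Lg\<^sup>2 * \<rho>\<^sup>2) * A\<^sup>2 * w + (4 * c * Q * \<rho> ^ 3) * A\<^sup>2 * v\<^sup>2"
  proof -
    have "c * r * (2 * L\<^sup>2 * B\<^sup>2 * G\<^sup>2) \<le> c * r * (2 * L\<^sup>2 * B\<^sup>2 * (2 * Lg\<^sup>2 * u\<^sup>2 + 2 * Lg\<^sup>2 * (L + 1)\<^sup>2 * v\<^sup>2))"
      using G2 pos r0 by (intro mult_left_mono) auto
    also have "\<dots> = (4 * L\<^sup>2 * Lg\<^sup>2 * A\<^sup>2 * w) * r\<^sup>2 + (4 * c * Q * A\<^sup>2 * v\<^sup>2) * r ^ 3"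
      unfolding w_def B Q_def by (simp add: algebra_simps power2_eq_square power3_eq_cube)
    also have "\<dots> \<le> (4 * L\<^sup>2 * Lg\<^sup>2 * A\<^sup>2 * w) * \<rho>\<^sup>2 + (4 * c * Q * A\<^sup>2 * v\<^sup>2) * \<rho> ^ 3"
      using pos L0 w0 r2 Q0 by (intro add_mono mult_left_mono) auto
    finally show ?thesis by (simp add: algebra_simps)
  qed
  have N1: "c * r * (2 * L\<^sup>2 * B\<^sup>2 * s\<^sup>2) \<le> c * (2 * L\<^sup>2) * (B ^ 3 / A\<^sup>2) * s\<^sup>2"
  proof -
    have "c * r * (2 * L\<^sup>2 * B\<^sup>2 * s\<^sup>2) = c * (2 * L\<^sup>2) * (B ^ 3 / A) * s\<^sup>2"
      unfolding r by (simp add: power2_eq_square power3_eq_cube)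
    also have "\<dots> \<le> c * (2 * L\<^sup>2) * (B ^ 3 / A\<^sup>2) * s\<^sup>2"
      using pos B3 by (intro mult_right_mono mult_left_mono) auto
    finally show ?thesis .
  qed
  have N2: "B\<^sup>2 * s\<^sup>2 \<le> B ^ 3 / A\<^sup>2 * s\<^sup>2"
  proof -
    have "B\<^sup>2 * A\<^sup>2 \<le> B\<^sup>2 * B" using AB by (intro mult_left_mono) auto
    then have "B\<^sup>2 \<le> B ^ 3 / A\<^sup>2" using pos by (simp add: pos_le_divide_eq power2_eq_square power3_eq_cube)
    then show ?thesis by (intro mult_right_mono) auto
  qed
  define H where "H = Lg * (u + (L + 1) * v)"
  have X: "c * r * (2 * ((1 + A * Lf) * u) * (L * B * (G + s)))
     \<le> c * r * (2 * u * (L * B * H)) + c * r * (2 * (A * Lf * u) * (L * B * H))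
       + c * r * (2 * u * (L * B * s)) + c * r * (2 * (A * Lf * u) * (L * B * s))"
  proof -
    have "c * r * (2 * ((1 + A * Lf) * u) * (L * B * (G + s))) \<le> c * r * (2 * ((1 + A * Lf) * u) * (L * B * (H + s)))"
      using pos r0 L0 u0 G unfolding H_def by (intro mult_left_mono add_right_mono) auto
    then show ?thesis by (simp add: algebra_simps)
  qed
  note X' = X[unfolded H_def]
  have cA: "c * r * (2 * A * \<mu>f * u\<^sup>2) = 2 * (c * \<mu>f * B * u\<^sup>2)"
    unfolding B by simp
  have Cw: "C * A\<^sup>2 * w \<ge> (Lf\<^sup>2 + 4 * L\<^sup>2 * Lg\<^sup>2 * \<rho>\<^sup>2 + (2 * Lf * L * Lg * \<rho>
        + 2 / \<mu>g * Lf\<^sup>2 * Q * \<beta>) + 1 / c * Lg\<^sup>2 * (L + 2) * \<rho>) * A\<^sup>2 * w"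
  proof -
    have "0 \<le> 4 * c * L\<^sup>2 * Lg\<^sup>2 * (L + 1)\<^sup>2 * \<rho> ^ 3 + Lg\<^sup>2 * (2 * L\<^sup>2 + L + 3) * \<rho>\<^sup>2"
      using pos L0 \<rho>0 by auto
    then show ?thesis unfolding C Q_def using w0
      by (intro mult_right_mono) (auto simp: mult.assoc)
  qed
  have Cv: "C * A\<^sup>2 * v\<^sup>2 \<ge> (4 * c * Q * \<rho> ^ 3 + Lg\<^sup>2 * (2 * L\<^sup>2 + L + 3) * \<rho>\<^sup>2) * A\<^sup>2 * v\<^sup>2"
  proof -
    have "0 \<le> Lf\<^sup>2 + 4 * L\<^sup>2 * Lg\<^sup>2 * \<rho>\<^sup>2 + 2 * Lf * L * Lg * \<rho>
        + 2 / \<mu>g * Lf\<^sup>2 * L\<^sup>2 * Lg\<^sup>2 * (L + 1)\<^sup>2 * \<beta> + 1 / c * Lg\<^sup>2 * (L + 2) * \<rho>"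
      using pos L0 \<rho>0 B\<beta> by (intro add_nonneg_nonneg mult_nonneg_nonneg divide_nonneg_nonneg) auto
    then show ?thesis unfolding C Q_def
      by (intro mult_right_mono) (auto simp: mult.assoc)
  qed
  have lhs: "c * r * ((1 - 2 * A * \<mu>f + A\<^sup>2 * Lf\<^sup>2) * u\<^sup>2 + 2 * L\<^sup>2 * B\<^sup>2 * (G\<^sup>2 + s\<^sup>2)
            + 2 * ((1 + A * Lf) * u) * (L * B * (G + s)))
         + (v\<^sup>2 - 2 * B * (\<mu>g * v\<^sup>2 - Lg * u * v) + B\<^sup>2 * (G\<^sup>2 + s\<^sup>2))
     = w - c * r * (2 * A * \<mu>f * u\<^sup>2) + Lf\<^sup>2 * A\<^sup>2 * w + c * r * (2 * L\<^sup>2 * B\<^sup>2 * G\<^sup>2)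
       + c * r * (2 * L\<^sup>2 * B\<^sup>2 * s\<^sup>2) + c * r * (2 * ((1 + A * Lf) * u) * (L * B * (G + s)))
       + v\<^sup>2 - 2 * (\<mu>g * B * v\<^sup>2) + 2 * B * (Lg * u * v) + B\<^sup>2 * G\<^sup>2 + B\<^sup>2 * s\<^sup>2"
    unfolding w_def by (simp add: algebra_simps)
  have rhs: "(1 - \<mu>g * B / 2 + C * A\<^sup>2) * (w + v\<^sup>2)
         + B ^ 3 / A\<^sup>2 * (c * (2 / \<mu>f * L\<^sup>2 + 2 / \<mu>f * Lf\<^sup>2 * L\<^sup>2 + 2 * L\<^sup>2) + 1) * s\<^sup>2
     = w + v\<^sup>2 - \<mu>g * B / 2 * w - \<mu>g * B * v\<^sup>2 / 2 + C * A\<^sup>2 * w + C * A\<^sup>2 * v\<^sup>2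
       + c * (2 / \<mu>f * L\<^sup>2) * (B ^ 3 / A\<^sup>2) * s\<^sup>2 + c * (2 / \<mu>f * Lf\<^sup>2 * L\<^sup>2) * (B ^ 3 / A\<^sup>2) * s\<^sup>2
       + c * (2 * L\<^sup>2) * (B ^ 3 / A\<^sup>2) * s\<^sup>2 + B ^ 3 / A\<^sup>2 * s\<^sup>2"
    by (simp add: algebra_simps)
  show ?thesis
    unfolding lhs w_def[symmetric] rhs
    using Y0 Y1 Y2 Y3 Y4 Y5 Y6 Y7 N1 N2 X' cA Cw Cv
    by (simp only: distrib_right)
qed

text \<open>The move of \<open>lam\<close> is only estimated by Lipschitz continuity, so its product with \<open>\<xi>\<close> is split by
\<open>(p + q)\<^sup>2 \<le> 2 p\<^sup>2 + 2 q\<^sup>2\<close>: this works for noises \<open>\<xi>\<close> and \<open>\<psi>\<close> with any correlation. The square of the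
norm of \<open>G + \<psi>\<close> is kept exact, so that its mixed term stays linear in \<open>\<psi>\<close> and averages out.\<close>

lemma drift_pointwise:
  fixes x x' F \<xi> :: "'a::real_inner" and y y' ys G \<psi> :: "'b::real_inner" and lam :: "'b \<Rightarrow> 'a"
  defines "u \<equiv> norm (x - lam y)" and "v \<equiv> norm (y - ys)"
  assumes x': "x' = x - A *\<^sub>R (F + \<xi>)" and y': "y' = y - B *\<^sub>R (G + \<psi>)"
    and pos: "A > 0" "B > 0" "w \<ge> 0" "L \<ge> 0" "Lf \<ge> 0"
    and F: "norm F \<le> Lf * u" "(x - lam y) \<bullet> F \<ge> \<mu>f * u\<^sup>2"
    and G: "(y - ys) \<bullet> G \<ge> \<mu>g * v\<^sup>2 - Lg * u * v"
    and lam: "norm (lam y - lam y') \<le> L * norm (y - y')"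
  shows "w * (norm (x' - lam y'))\<^sup>2 + (norm (y' - ys))\<^sup>2
    \<le> w * ((1 - 2 * A * \<mu>f + A\<^sup>2 * Lf\<^sup>2) * u\<^sup>2 + 2 * L\<^sup>2 * B\<^sup>2 * ((norm G)\<^sup>2 + (norm \<psi>)\<^sup>2)
            + 2 * ((1 + A * Lf) * u) * (L * B * (norm G + norm \<psi>)))
       + (v\<^sup>2 - 2 * B * (\<mu>g * v\<^sup>2 - Lg * u * v) + B\<^sup>2 * ((norm G)\<^sup>2 + (norm \<psi>)\<^sup>2))
       + 2 * w * A\<^sup>2 * (norm \<xi>)\<^sup>2
       + (- (2 * w * A) *\<^sub>R (x - lam y - A *\<^sub>R F)) \<bullet> \<xi>
       + ((4 * w * L\<^sup>2 * B\<^sup>2 + 2 * B\<^sup>2) *\<^sub>R G - (2 * B) *\<^sub>R (y - ys)) \<bullet> \<psi>"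
proof -
  define h where "h = x - lam y"
  define d where "d = h - A *\<^sub>R F"
  define \<Delta> where "\<Delta> = lam y - lam y'"
  have Gpsi: "(norm (G + \<psi>))\<^sup>2 = (norm G)\<^sup>2 + 2 * (G \<bullet> \<psi>) + (norm \<psi>)\<^sup>2"
    by (simp add: power2_norm_eq_inner inner_add inner_commute algebra_simps)
  have d2: "(norm d)\<^sup>2 \<le> (1 - 2 * A * \<mu>f + A\<^sup>2 * Lf\<^sup>2) * u\<^sup>2"
  proof -
    have "(norm d)\<^sup>2 = u\<^sup>2 - 2 * A * (h \<bullet> F) + A\<^sup>2 * (norm F)\<^sup>2"
      unfolding d_def u_def h_def[symmetric] power2_norm_eq_inner
      by (simp add: inner_diff_left inner_diff_right inner_commute algebra_simps power2_eq_square)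
    moreover have "2 * A * (\<mu>f * u\<^sup>2) \<le> 2 * A * (h \<bullet> F)"
      using F(2) pos unfolding h_def by (intro mult_left_mono) auto
    moreover have "A\<^sup>2 * (norm F)\<^sup>2 \<le> A\<^sup>2 * (Lf * u)\<^sup>2"
      using F(1) by (intro mult_left_mono power_mono) auto
    ultimately show ?thesis by (simp add: algebra_simps power_mult_distrib)
  qed
  have d1: "norm d \<le> (1 + A * Lf) * u"
  proof -
    have "norm d \<le> u + A * norm F"
      unfolding d_def u_def h_def using pos norm_triangle_ineq4[of "x - lam y" "A *\<^sub>R F"] by simp
    also have "\<dots> \<le> u + A * (Lf * u)" using F(1) pos by simp
    finally show ?thesis by (simp add: algebra_simps)
  qed
  have D1: "norm \<Delta> \<le> L * B * norm (G + \<psi>)"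
    using lam pos unfolding \<Delta>_def y' by (simp add: mult.assoc)
  have D1': "norm \<Delta> \<le> L * B * (norm G + norm \<psi>)"
    by (rule order_trans[OF D1]) (use pos norm_triangle_ineq in \<open>auto intro!: mult_left_mono\<close>)
  have D2: "(norm \<Delta>)\<^sup>2 \<le> L\<^sup>2 * B\<^sup>2 * ((norm G)\<^sup>2 + 2 * (G \<bullet> \<psi>) + (norm \<psi>)\<^sup>2)"
    using power_mono[OF D1 norm_ge_zero, of 2] unfolding Gpsi[symmetric]
    by (simp add: power_mult_distrib)
  have dD: "d \<bullet> \<Delta> \<le> ((1 + A * Lf) * u) * (L * B * (norm G + norm \<psi>))"
  proof -
    have "d \<bullet> \<Delta> \<le> norm d * norm \<Delta>" by (rule norm_cauchy_schwarz)
    also have "\<dots> \<le> ((1 + A * Lf) * u) * (L * B * (norm G + norm \<psi>))"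
      using d1 D1' pos by (intro mult_mono) (auto simp: u_def)
    finally show ?thesis .
  qed
  have split: "(norm (\<Delta> - A *\<^sub>R \<xi>))\<^sup>2 \<le> 2 * (norm \<Delta>)\<^sup>2 + 2 * A\<^sup>2 * (norm \<xi>)\<^sup>2"
  proof -
    have "0 \<le> (\<Delta> + A *\<^sub>R \<xi>) \<bullet> (\<Delta> + A *\<^sub>R \<xi>)" by simp
    then show ?thesis unfolding power2_norm_eq_inner
      by (simp add: inner_add_left inner_add_right inner_diff_left inner_diff_right inner_commute
          algebra_simps power2_eq_square)
  qed
  have "(norm (x' - lam y'))\<^sup>2 = (norm (d + (\<Delta> - A *\<^sub>R \<xi>)))\<^sup>2"
    unfolding x' d_def h_def \<Delta>_def by (simp add: algebra_simps)
  also have "\<dots> = (norm d)\<^sup>2 + 2 * (d \<bullet> \<Delta>) - 2 * A * (d \<bullet> \<xi>) + (norm (\<Delta> - A *\<^sub>R \<xi>))\<^sup>2"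
    by (simp add: power2_norm_eq_inner inner_add inner_diff inner_commute algebra_simps)
  finally have xx: "(norm (x' - lam y'))\<^sup>2 \<le> (1 - 2 * A * \<mu>f + A\<^sup>2 * Lf\<^sup>2) * u\<^sup>2
     + 2 * (((1 + A * Lf) * u) * (L * B * (norm G + norm \<psi>))) - 2 * A * (d \<bullet> \<xi>)
     + 2 * (L\<^sup>2 * B\<^sup>2 * ((norm G)\<^sup>2 + 2 * (G \<bullet> \<psi>) + (norm \<psi>)\<^sup>2)) + 2 * A\<^sup>2 * (norm \<xi>)\<^sup>2"
    using d2 dD split D2 by linarith
  have "(norm (y' - ys))\<^sup>2 = (norm ((y - ys) - B *\<^sub>R (G + \<psi>)))\<^sup>2"
    unfolding y' by (simp add: algebra_simps)
  also have "\<dots> = v\<^sup>2 - 2 * B * ((y - ys) \<bullet> G) - 2 * B * ((y - ys) \<bullet> \<psi>) + B\<^sup>2 * (norm (G + \<psi>))\<^sup>2"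
    unfolding v_def power2_norm_eq_inner
    by (simp add: inner_diff_left inner_diff_right inner_add_right inner_add_left inner_commute algebra_simps power2_eq_square)
  also have "\<dots> \<le> v\<^sup>2 - 2 * B * (\<mu>g * v\<^sup>2 - Lg * u * v) - 2 * B * ((y - ys) \<bullet> \<psi>)
      + B\<^sup>2 * ((norm G)\<^sup>2 + 2 * (G \<bullet> \<psi>) + (norm \<psi>)\<^sup>2)"
    unfolding Gpsi using G pos by (intro add_right_mono diff_right_mono diff_left_mono mult_left_mono) auto
  finally have yy: "(norm (y' - ys))\<^sup>2 \<le> v\<^sup>2 - 2 * B * (\<mu>g * v\<^sup>2 - Lg * u * v) - 2 * B * ((y - ys) \<bullet> \<psi>)
      + B\<^sup>2 * ((norm G)\<^sup>2 + 2 * (G \<bullet> \<psi>) + (norm \<psi>)\<^sup>2)" .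
  have p: "(- (2 * w * A) *\<^sub>R (x - lam y - A *\<^sub>R F)) \<bullet> \<xi> = - (w * (2 * A * (d \<bullet> \<xi>)))"
    unfolding d_def h_def by simp
  have q: "((4 * w * L\<^sup>2 * B\<^sup>2 + 2 * B\<^sup>2) *\<^sub>R G - (2 * B) *\<^sub>R (y - ys)) \<bullet> \<psi>
     = w * (2 * (L\<^sup>2 * B\<^sup>2 * (2 * (G \<bullet> \<psi>)))) + B\<^sup>2 * (2 * (G \<bullet> \<psi>)) - 2 * B * ((y - ys) \<bullet> \<psi>)"
    by (simp add: inner_diff_left algebra_simps)
  show ?thesis
    using add_mono[OF mult_left_mono[OF xx pos(3)] yy] unfolding p q
    by (simp add: algebra_simps)
qed

section \<open>Conditional moments of the noise\<close>

text \<open>The right-hand side is the tangent at \<open>u\<^sup>2 = z\<close> of the concave function \<open>u\<^sup>2 \<mapsto> (u\<^sup>2)\<^sup>\<delta>\<close>. Using it in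
place of Jensen's inequality gives an integrable majorant and the bound on the mean at once, and
covers the convention \<open>0\<^sup>0 = 1\<close>.\<close>

lemma rpow_le_tangent:
  assumes "0 \<le> \<delta>" "\<delta> < 1" "z > 0" "u \<ge> 0"
  shows "rpow u (2 * \<delta>) \<le> \<delta> * z powr (\<delta> - 1) * u\<^sup>2 + (1 - \<delta>) * z powr \<delta>"
proof (cases "\<delta> = 0 \<or> u = 0")
  case True
  then show ?thesis using assms by (auto simp: rpow_def)
next
  case False
  then have u: "u > 0" and \<delta>: "\<delta> > 0" using assms by auto
  have "rpow u (2 * \<delta>) = (u\<^sup>2) powr \<delta>"
    using u \<delta> by (simp add: rpow_def powr_powr[symmetric])
  also have "\<dots> = z powr \<delta> * ((u\<^sup>2 / z) powr \<delta> * 1 powr (1 - \<delta>))"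
    using assms u by (simp add: powr_divide)
  also have "\<dots> \<le> z powr \<delta> * (\<delta> * (u\<^sup>2 / z) + (1 - \<delta>) * 1)"
    using assms u \<delta> by (intro mult_left_mono Youngs_inequality_0) auto
  also have "\<dots> = \<delta> * z powr (\<delta> - 1) * u\<^sup>2 + (1 - \<delta>) * z powr \<delta>"
    using assms by (simp add: powr_diff field_simps)
  finally show ?thesis .
qed

text \<open>The mean of the tangent at \<open>z\<close> is at most \<open>z\<^sup>\<delta>\<close> if the mean of the square is at most \<open>z\<close>.\<close>

lemma second_moment_bound:
  fixes Z :: "'w \<Rightarrow> 'a::euclidean_space"
  assumes "prob_space P" and sub: "subalgebra P F" and Z[measurable]: "Z \<in> borel_measurable P"
    and bnd: "AE \<omega> in P. nn_cond_exp P F (\<lambda>w. ennreal ((norm (Z w))\<^sup>2)) \<omega>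
       \<le> ennreal (\<Gamma>1 * rpow (U \<omega>) (2 * \<delta>1) + \<Gamma>2 * rpow (W \<omega>) (2 * \<delta>2))"
    and U: "\<And>\<omega>. U \<omega> \<ge> 0" "integrable P (\<lambda>\<omega>. (U \<omega>)\<^sup>2)" "(\<integral>\<omega>. (U \<omega>)\<^sup>2 \<partial>P) \<le> z1" "z1 > 0"
    and W: "\<And>\<omega>. W \<omega> \<ge> 0" "integrable P (\<lambda>\<omega>. (W \<omega>)\<^sup>2)" "(\<integral>\<omega>. (W \<omega>)\<^sup>2 \<partial>P) \<le> z2" "z2 > 0"
    and \<Gamma>: "\<Gamma>1 \<ge> 0" "\<Gamma>2 \<ge> 0" and \<delta>: "0 \<le> \<delta>1" "\<delta>1 < 1" "0 \<le> \<delta>2" "\<delta>2 < 1"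
  shows "integrable P (\<lambda>\<omega>. (norm (Z \<omega>))\<^sup>2)"
    and "(\<integral>\<omega>. (norm (Z \<omega>))\<^sup>2 \<partial>P) \<le> \<Gamma>1 * z1 powr \<delta>1 + \<Gamma>2 * z2 powr \<delta>2"
proof -
  interpret prob_space P by fact
  interpret finite_measure_subalgebra P F by unfold_locales (rule sub)
  define T where "T = (\<lambda>\<delta> z (u::real). \<delta> * z powr (\<delta> - 1) * u\<^sup>2 + (1 - \<delta>) * z powr \<delta>)"
  define h where "h = (\<lambda>\<omega>. \<Gamma>1 * T \<delta>1 z1 (U \<omega>) + \<Gamma>2 * T \<delta>2 z2 (W \<omega>))"
  have intT: "integrable P (\<lambda>\<omega>. T \<delta>1 z1 (U \<omega>))" "integrable P (\<lambda>\<omega>. T \<delta>2 z2 (W \<omega>))"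
    unfolding T_def using U(2) W(2) by auto
  have ET: "(\<integral>\<omega>. T \<delta> z (S \<omega>) \<partial>P) \<le> z powr \<delta>"
    if "integrable P (\<lambda>\<omega>. (S \<omega>)\<^sup>2)" "(\<integral>\<omega>. (S \<omega>)\<^sup>2 \<partial>P) \<le> z" "z > 0" "0 \<le> \<delta>" for \<delta> z S
  proof -
    have "(\<integral>\<omega>. T \<delta> z (S \<omega>) \<partial>P) = \<delta> * z powr (\<delta> - 1) * (\<integral>\<omega>. (S \<omega>)\<^sup>2 \<partial>P) + (1 - \<delta>) * z powr \<delta>"
      unfolding T_def using that(1) by (simp add: prob_space)
    also have "\<dots> \<le> \<delta> * z powr (\<delta> - 1) * z + (1 - \<delta>) * z powr \<delta>"
      using that by (intro add_right_mono mult_left_mono) auto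
    also have "\<dots> = z powr \<delta>" using that by (simp add: powr_diff field_simps)
    finally show ?thesis .
  qed
  have inth: "integrable P h" unfolding h_def using intT by auto
  have Eh: "(\<integral>\<omega>. h \<omega> \<partial>P) \<le> \<Gamma>1 * z1 powr \<delta>1 + \<Gamma>2 * z2 powr \<delta>2"
    unfolding h_def using intT ET[OF U(2-4) \<delta>(1)] ET[OF W(2-4) \<delta>(3)] \<Gamma>
    by (auto intro!: add_mono mult_left_mono)
  have hle: "\<Gamma>1 * rpow (U \<omega>) (2 * \<delta>1) + \<Gamma>2 * rpow (W \<omega>) (2 * \<delta>2) \<le> h \<omega>" for \<omega>
    unfolding h_def T_def using U W \<Gamma> \<delta> by (intro add_mono mult_left_mono rpow_le_tangent) auto
  have h0: "h \<omega> \<ge> 0" for \<omega>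
    unfolding h_def T_def using \<Gamma> \<delta> by (intro add_nonneg_nonneg mult_nonneg_nonneg) auto
  have "(\<integral>\<^sup>+\<omega>. ennreal ((norm (Z \<omega>))\<^sup>2) \<partial>P)
      = (\<integral>\<^sup>+\<omega>. nn_cond_exp P F (\<lambda>w. ennreal ((norm (Z w))\<^sup>2)) \<omega> \<partial>P)"
    using nn_cond_exp_intg[of "\<lambda>_. 1" "\<lambda>w. ennreal ((norm (Z w))\<^sup>2)"] by simp
  also have "\<dots> \<le> (\<integral>\<^sup>+\<omega>. ennreal (h \<omega>) \<partial>P)"
    by (intro nn_integral_mono_AE eventually_mono[OF bnd])
       (meson hle ennreal_leI order_trans)
  also have "\<dots> = ennreal (\<integral>\<omega>. h \<omega> \<partial>P)"
    using inth h0 by (intro nn_integral_eq_integral) auto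
  finally have le: "(\<integral>\<^sup>+\<omega>. ennreal ((norm (Z \<omega>))\<^sup>2) \<partial>P) \<le> ennreal (\<integral>\<omega>. h \<omega> \<partial>P)" .
  then show int: "integrable P (\<lambda>\<omega>. (norm (Z \<omega>))\<^sup>2)"
    by (intro integrableI_nonneg) (auto simp: top_unique intro: le_less_trans)
  have "ennreal (\<integral>\<omega>. (norm (Z \<omega>))\<^sup>2 \<partial>P) \<le> ennreal (\<integral>\<omega>. h \<omega> \<partial>P)"
    using le int by (subst (asm) nn_integral_eq_integral) auto
  then have "(\<integral>\<omega>. (norm (Z \<omega>))\<^sup>2 \<partial>P) \<le> (\<integral>\<omega>. h \<omega> \<partial>P)"
    using h0 by (simp add: ennreal_le_iff)
  then show "(\<integral>\<omega>. (norm (Z \<omega>))\<^sup>2 \<partial>P) \<le> \<Gamma>1 * z1 powr \<delta>1 + \<Gamma>2 * z2 powr \<delta>2"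
    using Eh by simp
qed

text \<open>Square integrability of both factors makes each product of coordinates integrable, so that the
coordinates of \<open>p\<close> can be taken out of the conditional expectation.\<close>

lemma inner_cond_mean_zero:
  fixes p Z :: "'w \<Rightarrow> real ^ 'n"
  assumes "prob_space P" and sub: "subalgebra P F"
    and p[measurable]: "p \<in> borel_measurable F" and Z[measurable]: "Z \<in> borel_measurable P"
    and p2: "integrable P (\<lambda>\<omega>. (norm (p \<omega>))\<^sup>2)" and Z2: "integrable P (\<lambda>\<omega>. (norm (Z \<omega>))\<^sup>2)"
    and zero: "AE \<omega> in P. vec_cond_exp P F Z \<omega> = 0"
  shows "integrable P (\<lambda>\<omega>. p \<omega> \<bullet> Z \<omega>)" and "(\<integral>\<omega>. p \<omega> \<bullet> Z \<omega> \<partial>P) = 0"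
proof -
  interpret prob_space P by fact
  interpret finite_measure_subalgebra P F by unfold_locales (rule sub)
  have pP[measurable]: "p \<in> borel_measurable P" by (rule measurable_from_subalg[OF sub p])
  have nth: "(\<lambda>x. x $ i) \<in> borel_measurable borel" for i :: 'n
    by (intro borel_measurable_continuous_onI continuous_intros)
  have meas: "(\<lambda>\<omega>. h \<omega> $ i) \<in> borel_measurable N" if "h \<in> borel_measurable N" for h :: "'w \<Rightarrow> real ^ 'n" and N i
    by (rule measurable_compose[OF that nth])
  have int: "integrable P (\<lambda>\<omega>. p \<omega> $ i * Z \<omega> $ i)" for i
  proof (rule Bochner_Integration.integrable_bound)
    show "integrable P (\<lambda>\<omega>. (norm (p \<omega>))\<^sup>2 + (norm (Z \<omega>))\<^sup>2)" using p2 Z2 by auto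
    show "AE \<omega> in P. norm (p \<omega> $ i * Z \<omega> $ i) \<le> norm ((norm (p \<omega>))\<^sup>2 + (norm (Z \<omega>))\<^sup>2)"
    proof (rule AE_I2)
      fix \<omega>
      have "\<bar>p \<omega> $ i\<bar> * \<bar>Z \<omega> $ i\<bar> \<le> norm (p \<omega>) * norm (Z \<omega>)"
        by (intro mult_mono component_le_norm_cart) auto
      moreover have "2 * norm (p \<omega>) * norm (Z \<omega>) \<le> (norm (p \<omega>))\<^sup>2 + (norm (Z \<omega>))\<^sup>2"
        by (rule sum_squares_bound)
      moreover have "0 \<le> norm (p \<omega>) * norm (Z \<omega>)" by simp
      ultimately have "\<bar>p \<omega> $ i\<bar> * \<bar>Z \<omega> $ i\<bar> \<le> (norm (p \<omega>))\<^sup>2 + (norm (Z \<omega>))\<^sup>2" by linarith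
      then show "norm (p \<omega> $ i * Z \<omega> $ i) \<le> norm ((norm (p \<omega>))\<^sup>2 + (norm (Z \<omega>))\<^sup>2)"
        by (simp add: abs_mult)
    qed
  qed (auto intro!: borel_measurable_times meas)
  have E0: "(\<integral>\<omega>. p \<omega> $ i * Z \<omega> $ i \<partial>P) = 0" for i
  proof -
    have "AE \<omega> in P. real_cond_exp P F (\<lambda>w. Z w $ i) \<omega> = 0"
      using zero by eventually_elim (simp add: vec_cond_exp_def vec_eq_iff)
    then have "AE \<omega> in P. p \<omega> $ i * real_cond_exp P F (\<lambda>w. Z w $ i) \<omega> = 0"
      by eventually_elim simp
    then have "(\<integral>\<omega>. p \<omega> $ i * real_cond_exp P F (\<lambda>w. Z w $ i) \<omega> \<partial>P) = 0"
      by (rule integral_eq_zero_AE)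
    then show ?thesis
      using real_cond_exp_intg(2)[OF int[of i] meas[OF p] meas[OF Z]] by simp
  qed
  show "integrable P (\<lambda>\<omega>. p \<omega> \<bullet> Z \<omega>)" unfolding inner_vec_def using int by simp
  show "(\<integral>\<omega>. p \<omega> \<bullet> Z \<omega> \<partial>P) = 0" unfolding inner_vec_def using int E0 by simp
qed

lemma square_integrable_dominated:
  fixes Z :: "'w \<Rightarrow> 'a::euclidean_space" and U W :: "'w \<Rightarrow> real"
  assumes Z: "Z \<in> borel_measurable P"
    and U: "integrable P (\<lambda>\<omega>. (U \<omega>)\<^sup>2)" and W: "integrable P (\<lambda>\<omega>. (W \<omega>)\<^sup>2)"
    and le: "\<And>\<omega>. norm (Z \<omega>) \<le> a * U \<omega> + b * W \<omega>"
  shows "integrable P (\<lambda>\<omega>. (norm (Z \<omega>))\<^sup>2)"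
proof (rule Bochner_Integration.integrable_bound)
  show "integrable P (\<lambda>\<omega>. 2 * a\<^sup>2 * (U \<omega>)\<^sup>2 + 2 * b\<^sup>2 * (W \<omega>)\<^sup>2)" using U W by auto
  show "AE \<omega> in P. norm ((norm (Z \<omega>))\<^sup>2) \<le> norm (2 * a\<^sup>2 * (U \<omega>)\<^sup>2 + 2 * b\<^sup>2 * (W \<omega>)\<^sup>2)"
  proof (rule AE_I2)
    fix \<omega>
    have "(norm (Z \<omega>))\<^sup>2 \<le> (a * U \<omega> + b * W \<omega>)\<^sup>2" using le by (intro power_mono) auto
    also have "\<dots> \<le> 2 * (a * U \<omega>)\<^sup>2 + 2 * (b * W \<omega>)\<^sup>2"
      using sum_squares_bound[of "a * U \<omega>" "b * W \<omega>"] unfolding power2_sum by linarith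
    finally show "norm ((norm (Z \<omega>))\<^sup>2) \<le> norm (2 * a\<^sup>2 * (U \<omega>)\<^sup>2 + 2 * b\<^sup>2 * (W \<omega>)\<^sup>2)"
      by (simp add: power_mult_distrib)
  qed
qed (use Z in measurable)

lemma history_generators:
  fixes \<xi> :: "nat \<Rightarrow> 'w \<Rightarrow> real ^ 'd1" and \<psi> :: "nat \<Rightarrow> 'w \<Rightarrow> real ^ 'd2"
  assumes [measurable]: "u \<in> borel_measurable P" "v \<in> borel_measurable P"
    "\<And>i. \<xi> i \<in> borel_measurable P" "\<And>i. \<psi> i \<in> borel_measurable P"
  shows "subalgebra P (history P u v \<xi> \<psi> n)"
    and "u \<in> borel_measurable (history P u v \<xi> \<psi> n)" "v \<in> borel_measurable (history P u v \<xi> \<psi> n)"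
    and "i < n \<Longrightarrow> \<xi> i \<in> borel_measurable (history P u v \<xi> \<psi> n)"
    and "i < n \<Longrightarrow> \<psi> i \<in> borel_measurable (history P u v \<xi> \<psi> n)"
proof -
  define S where "S = {u -` A \<inter> space P | A. A \<in> sets borel} \<union>
      {v -` A \<inter> space P | A. A \<in> sets borel} \<union>
      (\<Union>i<n. {\<xi> i -` A \<inter> space P | A. A \<in> sets borel}) \<union>
      (\<Union>i<n. {\<psi> i -` A \<inter> space P | A. A \<in> sets borel})"
  have h: "history P u v \<xi> \<psi> n = sigma (space P) S" unfolding history_def S_def ..
  have S: "S \<subseteq> sets P" unfolding S_def by (auto intro: measurable_sets)
  then have Pow: "S \<subseteq> Pow (space P)" using sets.space_closed by blast
  show "subalgebra P (history P u v \<xi> \<psi> n)"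
    unfolding subalgebra_def h using S Pow by (auto simp: sets.sigma_sets_subset[OF S] subsetD[OF sets.sigma_sets_subset[OF S]])
  have meas: "z \<in> borel_measurable (history P u v \<xi> \<psi> n)"
    if "\<And>A. A \<in> sets borel \<Longrightarrow> z -` A \<inter> space P \<in> S" for z :: "'w \<Rightarrow> 'b::topological_space"
    unfolding h using that Pow by (intro measurableI) (auto simp: space_measure_of_conv)
  show "u \<in> borel_measurable (history P u v \<xi> \<psi> n)" by (rule meas) (auto simp: S_def)
  show "v \<in> borel_measurable (history P u v \<xi> \<psi> n)" by (rule meas) (auto simp: S_def)
  show "\<xi> i \<in> borel_measurable (history P u v \<xi> \<psi> n)" if "i < n" using that by (intro meas) (auto simp: S_def)
  show "\<psi> i \<in> borel_measurable (history P u v \<xi> \<psi> n)" if "i < n" using that by (intro meas) (auto simp: S_def)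
qed

section \<open>Expected drift of the coupled system\<close>

lemma lipschitz_pair_measurable:
  fixes f :: "'a::euclidean_space \<Rightarrow> 'b::euclidean_space \<Rightarrow> 'c::euclidean_space"
  assumes lip: "\<And>x1 x2 y1 y2. norm (f x1 y1 - f x2 y2) \<le> L * (norm (x1 - x2) + norm (y1 - y2))"
    and L: "L \<ge> 0" and [measurable]: "x \<in> borel_measurable N" "y \<in> borel_measurable N"
  shows "(\<lambda>\<omega>. f (x \<omega>) (y \<omega>)) \<in> borel_measurable N"
proof (rule borel_measurable_continuous_Pair[where H = f])
  have "(2 * L)-lipschitz_on UNIV (\<lambda>p. f (fst p) (snd p))"
  proof (rule lipschitz_onI)
    fix p q :: "'a \<times> 'b"
    have "dist (f (fst p) (snd p)) (f (fst q) (snd q)) \<le> L * (dist (fst p) (fst q) + dist (snd p) (snd q))"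
      using lip by (simp add: dist_norm)
    also have "\<dots> \<le> L * (dist p q + dist p q)"
      using L by (intro mult_left_mono add_mono dist_fst_le dist_snd_le) auto
    finally show "dist (f (fst p) (snd p)) (f (fst q) (snd q)) \<le> 2 * L * dist p q" by simp
  qed (use L in auto)
  then show "continuous_on UNIV (\<lambda>p. f (fst p) (snd p))" by (rule lipschitz_on_continuous_on)
qed measurable

locale coupled_system =
  fixes f :: "real ^ 'd1 \<Rightarrow> real ^ 'd2 \<Rightarrow> real ^ 'd1"
    and g :: "real ^ 'd1 \<Rightarrow> real ^ 'd2 \<Rightarrow> real ^ 'd2"
    and lam :: "real ^ 'd2 \<Rightarrow> real ^ 'd1" and ys :: "real ^ 'd2"
    and L Lf Lg \<mu>f \<mu>g :: real
  assumes lam_root: "f (lam y) y = 0" and g_root: "g (lam ys) ys = 0"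
    and lam_lipschitz: "norm (lam y1 - lam y2) \<le> L * norm (y1 - y2)"
    and f_lipschitz: "norm (f x1 y1 - f x2 y2) \<le> Lf * (norm (x1 - x2) + norm (y1 - y2))"
    and g_lipschitz: "norm (g x1 y1 - g x2 y2) \<le> Lg * (norm (x1 - x2) + norm (y1 - y2))"
    and f_monotone: "(x1 - x2) \<bullet> (f x1 y - f x2 y) \<ge> \<mu>f * (norm (x1 - x2))\<^sup>2"
    and g_monotone: "(y - ys) \<bullet> g (lam y) y \<ge> \<mu>g * (norm (y - ys))\<^sup>2"
    and mu_pos: "\<mu>f > 0" "\<mu>g > 0"
begin

text \<open>The spaces contain two distinct points, which fixes the sign of a Lipschitz constant.\<close>

lemma L_nonneg: "L \<ge> 0"
proof -
  have "0 \<le> L * norm (1 :: real ^ 'd2)"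
    using order_trans[OF norm_ge_zero lam_lipschitz[of 1 0]] by simp
  then show ?thesis by (simp add: zero_le_mult_iff)
qed

lemma Lf_nonneg: "Lf \<ge> 0"
proof -
  have "0 \<le> Lf * norm (1 :: real ^ 'd1)"
    using order_trans[OF norm_ge_zero f_lipschitz[of 1 0 0 0]] by simp
  then show ?thesis by (simp add: zero_le_mult_iff)
qed

text \<open>If \<open>Lg\<close> were not positive, \<open>g\<close> could not vary along \<open>lam\<close>, against the strong monotonicity.
This is what makes \<open>c\<close> positive.\<close>

lemma Lg_pos: "Lg > 0"
proof -
  define y where "y = ys + 1"
  have n: "y - ys = 1" "norm (1 :: real ^ 'd2) > 0" by (simp_all add: y_def)
  have "0 < \<mu>g * (norm (y - ys))\<^sup>2" unfolding n using mu_pos n by simp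
  also have "\<dots> \<le> (y - ys) \<bullet> g (lam y) y" by (rule g_monotone)
  also have "\<dots> \<le> norm (y - ys) * norm (g (lam y) y - g (lam ys) ys)"
    by (simp add: g_root norm_cauchy_schwarz)
  also have "\<dots> \<le> norm (y - ys) * (Lg * (norm (lam y - lam ys) + norm (y - ys)))"
    by (intro mult_left_mono g_lipschitz) auto
  finally have "0 < Lg * (norm (lam y - lam ys) + norm (y - ys))"
    by (simp add: zero_less_mult_iff)
  then show ?thesis using norm_ge_zero[of "lam y - lam ys"] norm_ge_zero[of "y - ys"]
    by (auto simp: zero_less_mult_iff)
qed

lemma f_le: "norm (f x y) \<le> Lf * norm (x - lam y)"
  using f_lipschitz[of x y "lam y" y] by (simp add: lam_root)

lemma f_inner_ge: "(x - lam y) \<bullet> f x y \<ge> \<mu>f * (norm (x - lam y))\<^sup>2"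
  using f_monotone[of x "lam y" y] by (simp add: lam_root)

lemma g_diff_le: "norm (g x y - g (lam y) y) \<le> Lg * norm (x - lam y)"
  using g_lipschitz[of x y "lam y" y] by simp

lemma g_le: "norm (g x y) \<le> Lg * (norm (x - lam y) + (L + 1) * norm (y - ys))"
proof -
  have "norm (g (lam y) y - g (lam ys) ys) \<le> Lg * (L * norm (y - ys) + norm (y - ys))"
    by (rule order_trans[OF g_lipschitz]) (use Lg_pos lam_lipschitz in auto)
  then have "norm (g (lam y) y) \<le> Lg * ((L + 1) * norm (y - ys))"
    by (simp add: g_root algebra_simps)
  moreover have "norm (g x y) \<le> norm (g x y - g (lam y) y) + norm (g (lam y) y)"
    using norm_triangle_ineq[of "g x y - g (lam y) y" "g (lam y) y"] by simp
  ultimately show ?thesis using g_diff_le[of x y] by (simp add: distrib_left)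
qed

lemma g_inner_ge:
  "(y - ys) \<bullet> g x y \<ge> \<mu>g * (norm (y - ys))\<^sup>2 - Lg * norm (x - lam y) * norm (y - ys)"
proof -
  have "\<bar>(y - ys) \<bullet> (g x y - g (lam y) y)\<bar> \<le> norm (y - ys) * (Lg * norm (x - lam y))"
    by (rule order_trans[OF Cauchy_Schwarz_ineq2]) (intro mult_left_mono g_diff_le, simp)
  moreover have "(y - ys) \<bullet> g x y = (y - ys) \<bullet> g (lam y) y + (y - ys) \<bullet> (g x y - g (lam y) y)"
    by (simp add: inner_diff_right)
  ultimately show ?thesis using g_monotone[of y] by (simp add: ac_simps)
qed

lemma f_measurable: "x \<in> borel_measurable N \<Longrightarrow> y \<in> borel_measurable N \<Longrightarrow>
    (\<lambda>\<omega>. f (x \<omega>) (y \<omega>)) \<in> borel_measurable N"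
  by (rule lipschitz_pair_measurable[OF f_lipschitz Lf_nonneg])

lemma g_measurable: "x \<in> borel_measurable N \<Longrightarrow> y \<in> borel_measurable N \<Longrightarrow>
    (\<lambda>\<omega>. g (x \<omega>) (y \<omega>)) \<in> borel_measurable N"
  using Lg_pos by (intro lipschitz_pair_measurable[OF g_lipschitz]) auto

lemma lam_measurable:
  assumes "y \<in> borel_measurable N"
  shows "(\<lambda>\<omega>. lam (y \<omega>)) \<in> borel_measurable N"
proof -
  have "L-lipschitz_on UNIV lam"
    using lam_lipschitz L_nonneg by (intro lipschitz_onI) (auto simp: dist_norm)
  then have "lam \<in> borel_measurable borel"
    by (intro borel_measurable_continuous_onI lipschitz_on_continuous_on)
  then show ?thesis using assms by (rule measurable_compose[rotated])
qed

definition lyap :: "real \<Rightarrow> real ^ 'd1 \<Rightarrow> real ^ 'd2 \<Rightarrow> real" where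
  "lyap w x y = w * (norm (x - lam y))\<^sup>2 + (norm (y - ys))\<^sup>2"

lemma lyap_measurable:
  assumes [measurable]: "x \<in> borel_measurable N" "y \<in> borel_measurable N"
  shows "(\<lambda>\<omega>. lyap w (x \<omega>) (y \<omega>)) \<in> borel_measurable N"
proof -
  have [measurable]: "(\<lambda>\<omega>. lam (y \<omega>)) \<in> borel_measurable N"
    by (rule lam_measurable) fact
  show ?thesis unfolding lyap_def by measurable
qed

text \<open>Both conclusions come from the pointwise drift: its right-hand side is integrable, which also shows
that the next iterate has finite second moments. The number \<open>R\<close> may exceed the current expected
Lyapunov function; it is only used to bound the second moments of the noises.\<close>

lemma expected_drift:
  fixes x x' \<xi> :: "'w \<Rightarrow> real ^ 'd1" and y y' \<psi> :: "'w \<Rightarrow> real ^ 'd2"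
  assumes D: "D = c * (2 / \<mu>f * L\<^sup>2 + 2 / \<mu>f * Lf\<^sup>2 * L\<^sup>2 + 2 * L\<^sup>2) + 1"
    and P: "prob_space P" and sub: "subalgebra P F"
    and xF[measurable]: "x \<in> borel_measurable F" and yF[measurable]: "y \<in> borel_measurable F"
    and \<xi>[measurable]: "\<xi> \<in> borel_measurable P" and \<psi>[measurable]: "\<psi> \<in> borel_measurable P"
    and x': "\<And>\<omega>. \<omega> \<in> space P \<Longrightarrow> x' \<omega> = x \<omega> - A *\<^sub>R (f (x \<omega>) (y \<omega>) + \<xi> \<omega>)"
    and y': "\<And>\<omega>. \<omega> \<in> space P \<Longrightarrow> y' \<omega> = y \<omega> - B *\<^sub>R (g (x \<omega>) (y \<omega>) + \<psi> \<omega>)"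
    and mean: "AE \<omega> in P. vec_cond_exp P F \<xi> \<omega> = 0" "AE \<omega> in P. vec_cond_exp P F \<psi> \<omega> = 0"
    and var\<xi>: "AE \<omega> in P. nn_cond_exp P F (\<lambda>w. ennreal ((norm (\<xi> w))\<^sup>2)) \<omega>
         \<le> ennreal (\<Gamma>11 * rpow (norm (x \<omega> - lam (y \<omega>))) (2 * \<delta>11)
                    + \<Gamma>12 * rpow (norm (y \<omega> - ys)) (2 * \<delta>12))"
    and var\<psi>: "AE \<omega> in P. nn_cond_exp P F (\<lambda>w. ennreal ((norm (\<psi> w))\<^sup>2)) \<omega>
         \<le> ennreal (\<Gamma>21 * rpow (norm (x \<omega> - lam (y \<omega>))) (2 * \<delta>21)
                    + \<Gamma>22 * rpow (norm (y \<omega> - ys)) (2 * \<delta>22))"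
    and \<Gamma>: "\<Gamma>11 \<ge> 0" "\<Gamma>12 \<ge> 0" "\<Gamma>21 \<ge> 0" "\<Gamma>22 \<ge> 0"
    and \<delta>: "\<delta>11 \<in> {0..<1}" "\<delta>12 \<in> {0..<1}" "\<delta>21 \<in> {0..<1}" "\<delta>22 \<in> {0..<1}"
    and AB0: "A > 0" "B > 0" and c: "c = 4 * Lg\<^sup>2 / (\<mu>f * \<mu>g)" and r: "r = B / A"
    and A1: "A \<le> 1" and AB: "A\<^sup>2 \<le> B" and B\<beta>: "B \<le> \<beta>" and r\<rho>: "r \<le> \<rho>"
    and ratio: "r * (4 / \<mu>f * (2 * L * Lg + 2 / \<mu>g * L\<^sup>2 * Lg\<^sup>2 * (L + 1)\<^sup>2)) \<le> 1"
    and rc: "r * (2 * c) \<le> 1" and rmu: "r * \<mu>g \<le> \<mu>f"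
    and C: "C = Lf\<^sup>2 + 4 * L\<^sup>2 * Lg\<^sup>2 * \<rho>\<^sup>2 + 2 * Lf * L * Lg * \<rho>
        + 2 / \<mu>g * Lf\<^sup>2 * L\<^sup>2 * Lg\<^sup>2 * (L + 1)\<^sup>2 * \<beta>
        + 1 / c * Lg\<^sup>2 * (L + 2) * \<rho>
        + 4 * c * L\<^sup>2 * Lg\<^sup>2 * (L + 1)\<^sup>2 * \<rho> ^ 3
        + Lg\<^sup>2 * (2 * L\<^sup>2 + L + 3) * \<rho>\<^sup>2"
    and intV: "integrable P (\<lambda>\<omega>. lyap (c * r) (x \<omega>) (y \<omega>))"
    and EV: "(\<integral>\<omega>. lyap (c * r) (x \<omega>) (y \<omega>) \<partial>P) \<le> R" and R: "R > 0"
  shows "integrable P (\<lambda>\<omega>. lyap (c * r) (x' \<omega>) (y' \<omega>))"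
    and "(\<integral>\<omega>. lyap (c * r) (x' \<omega>) (y' \<omega>) \<partial>P)
      \<le> (1 - \<mu>g * B / 2 + C * A\<^sup>2) * (\<integral>\<omega>. lyap (c * r) (x \<omega>) (y \<omega>) \<partial>P)
        + (2 * c * A * B * (\<Gamma>11 * (R / (c * r)) powr \<delta>11 + \<Gamma>12 * R powr \<delta>12)
          + B ^ 3 / A\<^sup>2 * D * (\<Gamma>21 * (R / (c * r)) powr \<delta>21 + \<Gamma>22 * R powr \<delta>22))"
proof -
  interpret prob_space P by (rule P)
  have cpos: "c > 0" unfolding c using Lg_pos mu_pos by simp
  have rpos: "r > 0" unfolding r using AB0 by simp
  define w where "w = c * r"
  have w0: "w > 0" unfolding w_def using cpos rpos by simp
  have wA: "w * A = c * B" unfolding w_def r using AB0 by simp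
  note V_int = intV[folded w_def] and V_le = EV[folded w_def]
  define u where "u \<omega> = norm (x \<omega> - lam (y \<omega>))" for \<omega>
  define v where "v \<omega> = norm (y \<omega> - ys)" for \<omega>
  have uv0: "u \<omega> \<ge> 0" "v \<omega> \<ge> 0" for \<omega> by (simp_all add: u_def v_def)
  have V_eq: "lyap w (x \<omega>) (y \<omega>) = w * (u \<omega>)\<^sup>2 + (v \<omega>)\<^sup>2" for \<omega>
    by (simp add: lyap_def u_def v_def)
  have lamF[measurable]: "(\<lambda>\<omega>. lam (y \<omega>)) \<in> borel_measurable F" by (rule lam_measurable[OF yF])
  have fF[measurable]: "(\<lambda>\<omega>. f (x \<omega>) (y \<omega>)) \<in> borel_measurable F" by (rule f_measurable[OF xF yF])
  have gF[measurable]: "(\<lambda>\<omega>. g (x \<omega>) (y \<omega>)) \<in> borel_measurable F" by (rule g_measurable[OF xF yF])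
  note toP = measurable_from_subalg[OF sub]
  have xP[measurable]: "x \<in> borel_measurable P" and yP[measurable]: "y \<in> borel_measurable P"
    using toP[OF xF] toP[OF yF] by auto
  have uF: "u \<in> borel_measurable F" and vF: "v \<in> borel_measurable F"
    unfolding u_def[abs_def] v_def[abs_def] by measurable
  have [measurable]: "u \<in> borel_measurable P" "v \<in> borel_measurable P"
    using toP[OF uF] toP[OF vF] by auto
  have u2: "integrable P (\<lambda>\<omega>. (u \<omega>)\<^sup>2)"
  proof (rule Bochner_Integration.integrable_bound)
    show "integrable P (\<lambda>\<omega>. lyap w (x \<omega>) (y \<omega>) / w)" using V_int by simp
    show "AE \<omega> in P. norm ((u \<omega>)\<^sup>2) \<le> norm (lyap w (x \<omega>) (y \<omega>) / w)"
      unfolding V_eq using w0 by (intro AE_I2) (simp add: field_simps)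
  qed measurable
  have v2: "integrable P (\<lambda>\<omega>. (v \<omega>)\<^sup>2)"
  proof (rule Bochner_Integration.integrable_bound)
    show "AE \<omega> in P. norm ((v \<omega>)\<^sup>2) \<le> norm (lyap w (x \<omega>) (y \<omega>))"
      unfolding V_eq using w0 by (intro AE_I2) simp
  qed (use V_int in auto)
  have Euv: "w * (\<integral>\<omega>. (u \<omega>)\<^sup>2 \<partial>P) + (\<integral>\<omega>. (v \<omega>)\<^sup>2 \<partial>P) \<le> R"
    using V_le u2 v2 unfolding V_eq by simp
  have E0: "0 \<le> (\<integral>\<omega>. (u \<omega>)\<^sup>2 \<partial>P)" "0 \<le> (\<integral>\<omega>. (v \<omega>)\<^sup>2 \<partial>P)" by simp_all
  have "w * (\<integral>\<omega>. (u \<omega>)\<^sup>2 \<partial>P) \<le> R" using Euv E0 by linarith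
  then have Eu: "(\<integral>\<omega>. (u \<omega>)\<^sup>2 \<partial>P) \<le> R / w"
    using w0 by (simp add: pos_le_divide_eq mult.commute)
  have "0 \<le> w * (\<integral>\<omega>. (u \<omega>)\<^sup>2 \<partial>P)" using w0 E0 by simp
  then have Ev: "(\<integral>\<omega>. (v \<omega>)\<^sup>2 \<partial>P) \<le> R" using Euv by linarith
  have Rw: "R / w > 0" using R w0 by simp
  note \<xi>2 = second_moment_bound[OF P sub \<xi> var\<xi>[folded u_def v_def] uv0(1) u2 Eu Rw uv0(2) v2 Ev R \<Gamma>(1,2)]
  note \<psi>2 = second_moment_bound[OF P sub \<psi> var\<psi>[folded u_def v_def] uv0(1) u2 Eu Rw uv0(2) v2 Ev R \<Gamma>(3,4)]
  have \<xi>int: "integrable P (\<lambda>\<omega>. (norm (\<xi> \<omega>))\<^sup>2)"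
    and \<xi>E: "(\<integral>\<omega>. (norm (\<xi> \<omega>))\<^sup>2 \<partial>P) \<le> \<Gamma>11 * (R / w) powr \<delta>11 + \<Gamma>12 * R powr \<delta>12"
    using \<xi>2 \<delta> by auto
  have \<psi>int: "integrable P (\<lambda>\<omega>. (norm (\<psi> \<omega>))\<^sup>2)"
    and \<psi>E: "(\<integral>\<omega>. (norm (\<psi> \<omega>))\<^sup>2 \<partial>P) \<le> \<Gamma>21 * (R / w) powr \<delta>21 + \<Gamma>22 * R powr \<delta>22"
    using \<psi>2 \<delta> by auto
  \<comment> \<open>The coefficients of the terms linear in the noise: measurable functions of the current state.\<close>
  define p where "p \<omega> = - (2 * w * A) *\<^sub>R (x \<omega> - lam (y \<omega>) - A *\<^sub>R f (x \<omega>) (y \<omega>))" for \<omega>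
  define q where "q \<omega> = (4 * w * L\<^sup>2 * B\<^sup>2 + 2 * B\<^sup>2) *\<^sub>R g (x \<omega>) (y \<omega>) - (2 * B) *\<^sub>R (y \<omega> - ys)" for \<omega>
  have pF: "p \<in> borel_measurable F" and qF: "q \<in> borel_measurable F"
    unfolding p_def[abs_def] q_def[abs_def] by measurable
  have p2: "integrable P (\<lambda>\<omega>. (norm (p \<omega>))\<^sup>2)"
  proof (rule square_integrable_dominated[OF toP[OF pF] u2 v2])
    fix \<omega>
    have "norm (x \<omega> - lam (y \<omega>) - A *\<^sub>R f (x \<omega>) (y \<omega>)) \<le> u \<omega> + A * norm (f (x \<omega>) (y \<omega>))"
      unfolding u_def using AB0 norm_triangle_ineq4[of "x \<omega> - lam (y \<omega>)" "A *\<^sub>R f (x \<omega>) (y \<omega>)"] by simp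
    also have "\<dots> \<le> u \<omega> + A * (Lf * u \<omega>)"
      unfolding u_def using AB0 f_le by (intro add_left_mono mult_left_mono) auto
    finally have "2 * w * A * norm (x \<omega> - lam (y \<omega>) - A *\<^sub>R f (x \<omega>) (y \<omega>)) \<le> 2 * w * A * (u \<omega> + A * (Lf * u \<omega>))"
      using w0 AB0 by (intro mult_left_mono) auto
    then show "norm (p \<omega>) \<le> (2 * w * A * (1 + A * Lf)) * u \<omega> + 0 * v \<omega>"
      unfolding p_def norm_scaleR using w0 AB0 by (simp add: algebra_simps)
  qed
  define k where "k = 4 * w * L\<^sup>2 * B\<^sup>2 + 2 * B\<^sup>2"
  have k0: "k \<ge> 0" unfolding k_def using w0 by simp
  have q2: "integrable P (\<lambda>\<omega>. (norm (q \<omega>))\<^sup>2)"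
  proof (rule square_integrable_dominated[OF toP[OF qF] u2 v2])
    fix \<omega>
    have "norm (q \<omega>) \<le> k * norm (g (x \<omega>) (y \<omega>)) + 2 * B * v \<omega>"
      unfolding q_def k_def[symmetric] v_def
      using norm_triangle_ineq4[of "k *\<^sub>R g (x \<omega>) (y \<omega>)" "(2 * B) *\<^sub>R (y \<omega> - ys)"] k0 AB0 by simp
    also have "\<dots> \<le> k * (Lg * (u \<omega> + (L + 1) * v \<omega>)) + 2 * B * v \<omega>"
      unfolding u_def v_def using g_le k0 by (intro add_right_mono mult_left_mono) auto
    finally show "norm (q \<omega>) \<le> (k * Lg) * u \<omega> + (k * Lg * (L + 1) + 2 * B) * v \<omega>"
      by (simp add: algebra_simps)
  qed
  note p\<xi> = inner_cond_mean_zero[OF P sub pF \<xi> p2 \<xi>int mean(1)]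
  note q\<psi> = inner_cond_mean_zero[OF P sub qF \<psi> q2 \<psi>int mean(2)]
  define \<kappa> where "\<kappa> = 1 - \<mu>g * B / 2 + C * A\<^sup>2"
  define N where "N = B ^ 3 / A\<^sup>2 * D"
  have N0: "N \<ge> 0"
    unfolding N_def D using AB0 cpos mu_pos by (intro mult_nonneg_nonneg add_nonneg_nonneg) auto
  define H where "H \<omega> = \<kappa> * lyap w (x \<omega>) (y \<omega>) + 2 * c * A * B * (norm (\<xi> \<omega>))\<^sup>2 + N * (norm (\<psi> \<omega>))\<^sup>2
      + p \<omega> \<bullet> \<xi> \<omega> + q \<omega> \<bullet> \<psi> \<omega>" for \<omega>
  have c': "c * \<mu>f * \<mu>g = 4 * Lg\<^sup>2" unfolding c using mu_pos by simp
  have pw: "lyap w (x' \<omega>) (y' \<omega>) \<le> H \<omega>" if \<omega>: "\<omega> \<in> space P" for \<omega>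
  proof -
    note Vx = drift_pointwise[OF x'[OF \<omega>] y'[OF \<omega>] AB0 less_imp_le[OF w0] L_nonneg Lf_nonneg
        f_le f_inner_ge g_inner_ge lam_lipschitz, folded p_def q_def u_def v_def]
    note Vs = drift_scalar[OF AB0 cpos mu_pos L_nonneg Lf_nonneg less_imp_le[OF Lg_pos]
        uv0(1) r c' A1 AB B\<beta> r\<rho> ratio rc rmu norm_ge_zero g_le[of "x \<omega>" "y \<omega>", folded u_def v_def] C,
        of "norm (\<psi> \<omega>)", folded D w_def N_def \<kappa>_def]
    have wAA: "2 * w * A\<^sup>2 = 2 * c * A * B" using wA by (simp add: power2_eq_square)
    show ?thesis unfolding H_def V_eq unfolding lyap_def using Vx[unfolded wAA] Vs by linarith
  qed
  have intH: "integrable P H"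
    unfolding H_def[abs_def] using V_int \<xi>int \<psi>int p\<xi>(1) q\<psi>(1) by auto
  have x'P: "x' \<in> borel_measurable P"
  proof (subst measurable_cong[OF x'])
    show "(\<lambda>\<omega>. x \<omega> - A *\<^sub>R (f (x \<omega>) (y \<omega>) + \<xi> \<omega>)) \<in> borel_measurable P"
      using toP[OF fF] by measurable
  qed
  have y'P: "y' \<in> borel_measurable P"
  proof (subst measurable_cong[OF y'])
    show "(\<lambda>\<omega>. y \<omega> - B *\<^sub>R (g (x \<omega>) (y \<omega>) + \<psi> \<omega>)) \<in> borel_measurable P"
      using toP[OF gF] by measurable
  qed
  have V0: "lyap w a b \<ge> 0" for a b unfolding lyap_def using w0 by simp
  have int': "integrable P (\<lambda>\<omega>. lyap w (x' \<omega>) (y' \<omega>))"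
  proof (rule Bochner_Integration.integrable_bound[OF intH lyap_measurable[OF x'P y'P]])
    show "AE \<omega> in P. norm (lyap w (x' \<omega>) (y' \<omega>)) \<le> norm (H \<omega>)"
      using pw V0 by (intro AE_I2) (simp add: order_trans[OF _ abs_ge_self])
  qed
  then show "integrable P (\<lambda>\<omega>. lyap (c * r) (x' \<omega>) (y' \<omega>))" unfolding w_def .
  have "(\<integral>\<omega>. lyap w (x' \<omega>) (y' \<omega>) \<partial>P) \<le> (\<integral>\<omega>. H \<omega> \<partial>P)"
    by (rule integral_mono[OF int' intH pw])
  also have "\<dots> = \<kappa> * (\<integral>\<omega>. lyap w (x \<omega>) (y \<omega>) \<partial>P) + 2 * c * A * B * (\<integral>\<omega>. (norm (\<xi> \<omega>))\<^sup>2 \<partial>P)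
      + N * (\<integral>\<omega>. (norm (\<psi> \<omega>))\<^sup>2 \<partial>P)"
    unfolding H_def[abs_def] using V_int \<xi>int \<psi>int p\<xi> q\<psi> by simp
  also have "\<dots> \<le> \<kappa> * (\<integral>\<omega>. lyap w (x \<omega>) (y \<omega>) \<partial>P)
      + (2 * c * A * B * (\<Gamma>11 * (R / w) powr \<delta>11 + \<Gamma>12 * R powr \<delta>12)
        + N * (\<Gamma>21 * (R / w) powr \<delta>21 + \<Gamma>22 * R powr \<delta>22))"
  proof -
    have "2 * c * A * B * (\<integral>\<omega>. (norm (\<xi> \<omega>))\<^sup>2 \<partial>P) \<le> 2 * c * A * B * (\<Gamma>11 * (R / w) powr \<delta>11 + \<Gamma>12 * R powr \<delta>12)"
      using \<xi>E cpos AB0 by (intro mult_left_mono) auto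
    moreover have "N * (\<integral>\<omega>. (norm (\<psi> \<omega>))\<^sup>2 \<partial>P) \<le> N * (\<Gamma>21 * (R / w) powr \<delta>21 + \<Gamma>22 * R powr \<delta>22)"
      using \<psi>E N0 by (intro mult_left_mono) auto
    ultimately show ?thesis by simp
  qed
  finally show "(\<integral>\<omega>. lyap (c * r) (x' \<omega>) (y' \<omega>) \<partial>P)
      \<le> (1 - \<mu>g * B / 2 + C * A\<^sup>2) * (\<integral>\<omega>. lyap (c * r) (x \<omega>) (y \<omega>) \<partial>P)
        + (2 * c * A * B * (\<Gamma>11 * (R / (c * r)) powr \<delta>11 + \<Gamma>12 * R powr \<delta>12)
          + B ^ 3 / A\<^sup>2 * D * (\<Gamma>21 * (R / (c * r)) powr \<delta>21 + \<Gamma>22 * R powr \<delta>22))"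
    unfolding w_def \<kappa>_def N_def .
qed

end

section \<open>Exponents and the rate\<close>

text \<open>The bound \<open>2/3 \<le> t\<close> holds because all four members of the minimum are at least \<open>2/3\<close> at \<open>x = 2/3\<close>.
It keeps the contraction faster than the loss in passing from \<open>K - 1\<close> to \<open>K\<close> also when \<open>t < 1\<close>.\<close>

lemma optimal_exponent:
  fixes \<delta>11 \<delta>12 \<delta>21 \<delta>22 :: real
  assumes \<delta>: "\<delta>11 \<in> {0..<1}" "\<delta>12 \<in> {0..<1}" "\<delta>21 \<in> {0..<1}" "\<delta>22 \<in> {0..<1}"
    and m: "m = (\<lambda>x. Min {((1 + \<delta>11) * x - \<delta>11) / (1 - \<delta>11), x / (1 - \<delta>12),
                   (2 - \<delta>21) * (1 - x) / (1 - \<delta>21), 2 * (1 - x) / (1 - \<delta>22)})"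
    and a: "a = arg_max m (\<lambda>x. x \<in> {1/2<..1})"
    and t: "t = (SUP x\<in>{1/2<..1}. m x)"
  shows "1 / 2 < a" "a \<le> 1" "2 / 3 \<le> t"
    "t * (1 - \<delta>11) \<le> (1 + \<delta>11) * a - \<delta>11" "t * (1 - \<delta>12) \<le> a"
    "t * (1 - \<delta>21) \<le> (2 - \<delta>21) * (1 - a)" "t * (1 - \<delta>22) \<le> 2 * (1 - a)"
proof -
  have m': "m = (\<lambda>x. min (((1 + \<delta>11) * x - \<delta>11) / (1 - \<delta>11)) (min (x / (1 - \<delta>12))
                   (min ((2 - \<delta>21) * (1 - x) / (1 - \<delta>21)) (2 * (1 - x) / (1 - \<delta>22)))))"
    unfolding m by (simp add: fun_eq_iff)
  \<comment> \<open>A maximiser on the closed interval exists by compactness and is not \<open>1/2\<close>, since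
    \<open>m (1/2) \<le> 1/2 < 2/3 \<le> m (2/3)\<close>.\<close>
  have "continuous_on {1/2..1} m"
    unfolding m' using \<delta> by (intro continuous_intros) auto
  then obtain x where x: "x \<in> {1/2..1}" "\<And>y. y \<in> {1/2..1} \<Longrightarrow> m y \<le> m x"
    using continuous_attains_sup[of "{1/2..1::real}" m] by auto
  have "m (1/2) \<le> ((1 + \<delta>11) * (1/2) - \<delta>11) / (1 - \<delta>11)" unfolding m' by (rule min.cobounded1)
  also have "\<dots> = 1 / 2" using \<delta> by (simp add: field_simps)
  finally have half: "m (1/2) \<le> 1 / 2" .
  have twothirds: "2 / 3 \<le> m (2/3)" unfolding m' using \<delta> by (simp add: field_simps)
  have "m (2/3) \<le> m x" by (rule x(2)) auto
  then have "x \<noteq> 1/2" using half twothirds by force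
  then have x': "x \<in> {1/2<..1}" using x by auto
  then have "is_arg_max m (\<lambda>x. x \<in> {1/2<..1}) x"
    unfolding is_arg_max_def not_less[symmetric] by (auto simp: not_less intro!: x(2))
  then have "is_arg_max m (\<lambda>x. x \<in> {1/2<..1}) a"
    unfolding a arg_max_def by (rule someI)
  then have a': "a \<in> {1/2<..1}" "\<And>y. y \<in> {1/2<..1} \<Longrightarrow> m y \<le> m a"
    unfolding is_arg_max_def by (auto simp: not_less)
  have ta: "t = m a" unfolding t using a' by (intro cSup_eq_maximum) auto
  show "1 / 2 < a" "a \<le> 1" using a' by auto
  show "2 / 3 \<le> t" using a'(2)[of "2/3"] twothirds ta by auto
  have "t \<le> ((1 + \<delta>11) * a - \<delta>11) / (1 - \<delta>11)" "t \<le> a / (1 - \<delta>12)"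
    "t \<le> (2 - \<delta>21) * (1 - a) / (1 - \<delta>21)" "t \<le> 2 * (1 - a) / (1 - \<delta>22)"
    unfolding ta m' by auto
  then show "t * (1 - \<delta>11) \<le> (1 + \<delta>11) * a - \<delta>11" "t * (1 - \<delta>12) \<le> a"
    "t * (1 - \<delta>21) \<le> (2 - \<delta>21) * (1 - a)" "t * (1 - \<delta>22) \<le> 2 * (1 - a)"
    using \<delta> by (simp_all add: pos_le_divide_eq)
qed

text \<open>Bernoulli's inequality for \<open>t \<ge> 1\<close>, and monotonicity of powers for \<open>t \<le> 1\<close>.\<close>

lemma powr_one_minus_ge:
  fixes s t :: real
  assumes "0 \<le> s" "s < 1" "t > 0"
  shows "1 - max 1 t * s \<le> (1 - s) powr t"
proof (cases "t \<le> 1")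
  case True
  have "(1 - s) powr 1 \<le> (1 - s) powr t" using assms True by (intro powr_mono') auto
  then show ?thesis using True assms by simp
next
  case False
  have "((1 - s) powr t) powr (1 / t) * 1 powr (1 - 1 / t) \<le> 1 / t * (1 - s) powr t + (1 - 1 / t) * 1"
    using False assms by (intro Youngs_inequality_0) auto
  then have "1 - s \<le> 1 / t * (1 - s) powr t + (1 - 1 / t)"
    using assms False by (simp add: powr_powr)
  then have "t * (1 - s) \<le> t * (1 / t * (1 - s) powr t + (1 - 1 / t))"
    using assms by (intro mult_left_mono) auto
  then show ?thesis using False by (simp add: algebra_simps)
qed

text \<open>With \<open>s = 1/K\<close> the claim reduces to \<open>1 - (2 a + t - 1/6) s \<le> (1 - s)\<^sup>t (1 - a s / 3)\<close>, where the last
factor makes room for \<open>N\<close>. By Bernoulli's inequality this follows from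
\<open>max 1 t + a/3 + 1/6 \<le> 2 a + t\<close>.\<close>

lemma rate_step:
  fixes K a t \<kappa> E N M :: real
  assumes K: "K > 1" and t: "2 / 3 \<le> t" and a: "1 / 2 < a" "a \<le> 1" and M: "M > 0"
    and \<kappa>: "\<kappa> \<le> 1 - (2 * a + t) / K + 1 / (6 * K)"
    and E: "0 \<le> E" "E \<le> M / (K - 1) powr t"
    and N: "N \<le> a / 3 * M / K powr (1 + t)"
  shows "\<kappa> * E + N \<le> M / K powr t"
proof -
  define s where "s = 1 / K"
  have s: "0 < s" "s < 1" unfolding s_def using K by auto
  have N': "N \<le> a * s / 3 * (M / K powr t)"
    using N K unfolding s_def by (simp add: powr_add)
  have MK: "M / K powr t > 0" using M K by simp
  have as: "0 \<le> a * s" "a * s \<le> 1" using a s by (auto intro: mult_le_one)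
  show ?thesis
  proof (cases "\<kappa> \<le> 0")
    case True
    \<comment> \<open>A large \<open>\<beta>\<close> can make the contraction factor negative in early steps.\<close>
    then have "\<kappa> * E \<le> 0" using E by (intro mult_nonpos_nonneg)
    moreover have "a * s / 3 * (M / K powr t) \<le> 1 * (M / K powr t)"
      using as MK by (intro mult_right_mono) auto
    ultimately show ?thesis using N' by simp
  next
    case False
    have "\<kappa> \<le> 1 - (2 * a + t - 1 / 6) * s" using \<kappa> unfolding s_def by (simp add: algebra_simps add_divide_distrib)
    also have "\<dots> \<le> 1 - (max 1 t + a / 3) * s"
    proof -
      have "(max 1 t + a / 3) * s \<le> (2 * a + t - 1 / 6) * s"
        using t a s by (intro mult_right_mono) auto
      then show ?thesis by simp
    qed
    also have "\<dots> \<le> (1 - max 1 t * s) * (1 - a * s / 3)"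
    proof -
      have "0 \<le> max 1 t * s * (a * s / 3)" using as s by (intro mult_nonneg_nonneg) auto
      then show ?thesis by (simp add: algebra_simps)
    qed
    also have "\<dots> \<le> (1 - s) powr t * (1 - a * s / 3)"
      using s t as by (intro mult_right_mono powr_one_minus_ge) auto
    finally have \<kappa>': "\<kappa> \<le> (1 - s) powr t * (1 - a * s / 3)" .
    have K1: "(1 - s) powr t = (K - 1) powr t / K powr t"
      unfolding s_def using K by (simp add: powr_divide[symmetric] diff_divide_distrib)
    have "\<kappa> * E \<le> \<kappa> * (M / (K - 1) powr t)" using E False by (intro mult_left_mono) auto
    also have "\<dots> \<le> (1 - s) powr t * (1 - a * s / 3) * (M / (K - 1) powr t)"
      using \<kappa>' M by (intro mult_right_mono) auto
    also have "\<dots> = (1 - a * s / 3) * (M / K powr t)" unfolding K1 using K by simp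
    finally have "\<kappa> * E \<le> (1 - a * s / 3) * (M / K powr t)" .
    then show ?thesis using N' by (simp add: algebra_simps)
  qed
qed

lemma powr_exponent_collect:
  fixes K :: real
  assumes "K \<ge> 1" "z \<ge> 0" "e + \<delta> * h \<le> - (1 + t)"
  shows "K powr e * (z * K powr h) powr \<delta> \<le> z powr \<delta> * K powr (- (1 + t))"
proof -
  have "K powr e * (z * K powr h) powr \<delta> = z powr \<delta> * K powr (e + \<delta> * h)"
    using assms by (simp add: powr_mult powr_powr powr_add mult.commute)
  also have "\<dots> \<le> z powr \<delta> * K powr (- (1 + t))"
    using assms by (intro mult_left_mono powr_mono) auto
  finally show ?thesis .
qed

lemma exists_dominating_powr_sum:
  fixes k1 k2 k3 k4 C :: real
  assumes "d1 < 1" "d2 < 1" "d3 < 1" "d4 < 1"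
  shows "\<exists>M>0. M \<ge> C \<and> M \<ge> k1 * M powr d1 + k2 * M powr d2 + k3 * M powr d3 + k4 * M powr d4"
proof -
  have lim: "((\<lambda>M::real. k * M powr (d - 1)) \<longlongrightarrow> 0) at_top" if "d < 1" for k d :: real
    using that by (intro tendsto_mult_right_zero tendsto_neg_powr filterlim_ident) auto
  have "((\<lambda>M. k1 * M powr (d1 - 1) + k2 * M powr (d2 - 1) + k3 * M powr (d3 - 1) + k4 * M powr (d4 - 1)) \<longlongrightarrow> 0 + 0 + 0 + 0) at_top"
    using assms by (intro tendsto_add lim)
  then have "eventually (\<lambda>M. k1 * M powr (d1 - 1) + k2 * M powr (d2 - 1) + k3 * M powr (d3 - 1) + k4 * M powr (d4 - 1) < 1) at_top"
    by (rule order_tendstoD) simp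
  then have "eventually (\<lambda>M. M > 0 \<and> M \<ge> C \<and> k1 * M powr (d1 - 1) + k2 * M powr (d2 - 1) + k3 * M powr (d3 - 1) + k4 * M powr (d4 - 1) < 1) at_top"
    using eventually_gt_at_top[of 0] eventually_ge_at_top[of C] by eventually_elim auto
  then obtain M :: real where M: "M > 0" "M \<ge> C"
    "k1 * M powr (d1 - 1) + k2 * M powr (d2 - 1) + k3 * M powr (d3 - 1) + k4 * M powr (d4 - 1) < 1"
    using eventually_happens'[OF trivial_limit_at_top_linorder] by blast
  have e: "M * (k * M powr (d - 1)) = k * M powr d" for k d
    using M(1) by (simp add: powr_diff)
  have "M * (k1 * M powr (d1 - 1) + k2 * M powr (d2 - 1) + k3 * M powr (d3 - 1) + k4 * M powr (d4 - 1)) \<le> M * 1"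
    using M by (intro mult_left_mono) auto
  then have "k1 * M powr d1 + k2 * M powr d2 + k3 * M powr d3 + k4 * M powr d4 \<le> M"
    unfolding distrib_left e by simp
  then show ?thesis using M by auto
qed

section \<open>Convergence rate\<close>

theorem theoremS1:
  fixes f :: "real ^ 'd1 \<Rightarrow> real ^ 'd2 \<Rightarrow> real ^ 'd1"
    and g :: "real ^ 'd1 \<Rightarrow> real ^ 'd2 \<Rightarrow> real ^ 'd2"
    and lam :: "real ^ 'd2 \<Rightarrow> real ^ 'd1"
    and xs x0 :: "real ^ 'd1" and ys y0 :: "real ^ 'd2"
    and P :: "'w measure"
    and X \<xi> :: "nat \<Rightarrow> 'w \<Rightarrow> real ^ 'd1" and Y \<psi> :: "nat \<Rightarrow> 'w \<Rightarrow> real ^ 'd2"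
    and \<alpha>s \<beta>s :: "nat \<Rightarrow> real"
    and m C2 :: "real \<Rightarrow> real"
    and V :: "nat \<Rightarrow> real ^ 'd1 \<Rightarrow> real ^ 'd2 \<Rightarrow> real"
    and L\<^sub>l L\<^sub>f L\<^sub>g \<mu>\<^sub>f \<mu>\<^sub>g \<alpha> \<beta> k0 a b t c Cab :: real
    and \<Gamma>11 \<Gamma>12 \<Gamma>21 \<Gamma>22 \<delta>11 \<delta>12 \<delta>21 \<delta>22 :: real
  assumes root: "f xs ys = 0 \<and> g xs ys = 0"
    and root_unique: "\<forall>x y. f x y = 0 \<and> g x y = 0 \<longrightarrow> x = xs \<and> y = ys"
    and lam_root: "\<forall>y. f (lam y) y = 0"
    and lam_unique: "\<forall>x y. f x y = 0 \<longrightarrow> x = lam y"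
    and lam_lipschitz: "\<forall>y1 y2. norm (lam y1 - lam y2) \<le> L\<^sub>l * norm (y1 - y2)"
    and f_lipschitz:
      "\<forall>x1 x2 y1 y2. norm (f x1 y1 - f x2 y2) \<le> L\<^sub>f * (norm (x1 - x2) + norm (y1 - y2))"
    and mu_f: "\<mu>\<^sub>f > 0"
    and f_monotone:
      "\<forall>x1 x2 y. (x1 - x2) \<bullet> (f x1 y - f x2 y) \<ge> \<mu>\<^sub>f * (norm (x1 - x2))\<^sup>2"
    and g_lipschitz:
      "\<forall>x1 x2 y1 y2. norm (g x1 y1 - g x2 y2) \<le> L\<^sub>g * (norm (x1 - x2) + norm (y1 - y2))"
    and mu_g: "\<mu>\<^sub>g > 0"
    and g_monotone: "\<forall>y. (y - ys) \<bullet> g (lam y) y \<ge> \<mu>\<^sub>g * (norm (y - ys))\<^sup>2"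
    and prob: "prob_space P"
    and noise_measurable:
      "\<forall>k. \<xi> k \<in> borel_measurable P" "\<forall>k. \<psi> k \<in> borel_measurable P"
    and init: "\<forall>\<omega>\<in>space P. X 0 \<omega> = x0 \<and> Y 0 \<omega> = y0"
    and X_step: "\<forall>k. \<forall>\<omega>\<in>space P.
      X (Suc k) \<omega> = X k \<omega> - \<alpha>s k *\<^sub>R (f (X k \<omega>) (Y k \<omega>) + \<xi> k \<omega>)"
    and Y_step: "\<forall>k. \<forall>\<omega>\<in>space P.
      Y (Suc k) \<omega> = Y k \<omega> - \<beta>s k *\<^sub>R (g (X k \<omega>) (Y k \<omega>) + \<psi> k \<omega>)"
    and noise_mean:
      "\<forall>k. AE \<omega> in P. vec_cond_exp P (history P (X 0) (Y 0) \<xi> \<psi> k) (\<xi> k) \<omega> = 0"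
      "\<forall>k. AE \<omega> in P. vec_cond_exp P (history P (X 0) (Y 0) \<xi> \<psi> k) (\<psi> k) \<omega> = 0"
    and Gamma_nonneg: "\<Gamma>11 \<ge> 0" "\<Gamma>12 \<ge> 0" "\<Gamma>21 \<ge> 0" "\<Gamma>22 \<ge> 0"
    and delta_range: "\<delta>11 \<in> {0..<1}" "\<delta>12 \<in> {0..<1}" "\<delta>21 \<in> {0..<1}" "\<delta>22 \<in> {0..<1}"
    and noise_second_moment:
      "AE \<omega> in P. \<forall>k.
         nn_cond_exp P (history P (X 0) (Y 0) \<xi> \<psi> k) (\<lambda>w. ennreal ((norm (\<xi> k w))\<^sup>2)) \<omega>
         \<le> ennreal (\<Gamma>11 * rpow (norm (X k \<omega> - lam (Y k \<omega>))) (2 * \<delta>11)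
                    + \<Gamma>12 * rpow (norm (Y k \<omega> - ys)) (2 * \<delta>12))"
      "AE \<omega> in P. \<forall>k.
         nn_cond_exp P (history P (X 0) (Y 0) \<xi> \<psi> k) (\<lambda>w. ennreal ((norm (\<psi> k w))\<^sup>2)) \<omega>
         \<le> ennreal (\<Gamma>21 * rpow (norm (X k \<omega> - lam (Y k \<omega>))) (2 * \<delta>21)
                    + \<Gamma>22 * rpow (norm (Y k \<omega> - ys)) (2 * \<delta>22))"
    and c_eq: "c = 4 * L\<^sub>g\<^sup>2 / (\<mu>\<^sub>f * \<mu>\<^sub>g)"
    and V_eq: "V = (\<lambda>k x y. c * (\<beta>s k / \<alpha>s k) * (norm (x - lam y))\<^sup>2 + (norm (y - ys))\<^sup>2)"
    and m_eq: "m = (\<lambda>x. Min {((1 + \<delta>11) * x - \<delta>11) / (1 - \<delta>11),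
                             x / (1 - \<delta>12),
                             (2 - \<delta>21) * (1 - x) / (1 - \<delta>21),
                             2 * (1 - x) / (1 - \<delta>22)})"
    and b_eq: "b = 1"
    and a_eq: "a = arg_max m (\<lambda>x. x \<in> {1/2<..1})"
    and t_eq: "t = (SUP x\<in>{1/2<..1}. m x)"
    and pos: "\<alpha> > 0" "\<beta> > 0" "k0 > 0"
    and alpha_step: "\<forall>k. \<alpha>s k = \<alpha> / (real k + 1 + k0) powr a"
    and beta_step: "\<forall>k. \<beta>s k = \<beta> / (real k + 1 + k0) powr b"
    and ratio: "\<alpha> / \<beta> \<ge>
      Max {4 / \<mu>\<^sub>f * (2 * L\<^sub>l * L\<^sub>g + 2 / \<mu>\<^sub>g * L\<^sub>l\<^sup>2 * L\<^sub>g\<^sup>2 * (L\<^sub>l + 1)\<^sup>2), 2 * c, \<mu>\<^sub>g / \<mu>\<^sub>f, 1}"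
    and beta_ge: "\<beta> \<ge> 2 / \<mu>\<^sub>g * (2 * a + t)"
    and Cab_eq: "Cab =
        L\<^sub>f\<^sup>2 + 4 * L\<^sub>l\<^sup>2 * L\<^sub>g\<^sup>2 * (\<beta>\<^sup>2 / \<alpha>\<^sup>2) + 2 * L\<^sub>f * L\<^sub>l * L\<^sub>g * (\<beta> / \<alpha>)
        + 2 / \<mu>\<^sub>g * L\<^sub>f\<^sup>2 * L\<^sub>l\<^sup>2 * L\<^sub>g\<^sup>2 * (L\<^sub>l + 1)\<^sup>2 * \<beta>
        + 1 / c * L\<^sub>g\<^sup>2 * (L\<^sub>l + 2) * (\<beta> / \<alpha>)
        + 4 * c * L\<^sub>l\<^sup>2 * L\<^sub>g\<^sup>2 * (L\<^sub>l + 1)\<^sup>2 * (\<beta> ^ 3 / \<alpha> ^ 3)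
        + L\<^sub>g\<^sup>2 * (2 * L\<^sub>l\<^sup>2 + L\<^sub>l + 3) * (\<beta>\<^sup>2 / \<alpha>\<^sup>2)"
    and k0_ge: "k0 \<ge>
      Max {\<alpha> powr (1 / a), (\<alpha>\<^sup>2 / \<beta>) powr (1 / (2 * a - 1)),
           1 / (2 powr (1 / t) - 1), 1 / (2 powr (1 / (2 * a)) - 1),
           (6 * Cab * \<alpha>\<^sup>2) powr (1 / (2 * a - 1))}"
    and C2_eq: "C2 = (\<lambda>M.
        2 * c * \<alpha> * \<beta> * \<Gamma>11 * (1 / c * (\<alpha> / \<beta>) * (2 * M)) powr \<delta>11
        + 2 * c * \<alpha> * \<beta> * \<Gamma>12 * (2 * M) powr \<delta>12
        + \<beta> ^ 3 / \<alpha>\<^sup>2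
          * (c * (2 / \<mu>\<^sub>f * L\<^sub>l\<^sup>2 + 2 / \<mu>\<^sub>f * L\<^sub>f\<^sup>2 * L\<^sub>l\<^sup>2 + 2 * L\<^sub>l\<^sup>2) + 1)
          * (\<Gamma>21 * (1 / c * (\<alpha> / \<beta>) * (2 * M)) powr \<delta>21 + \<Gamma>22 * (2 * M) powr \<delta>22))"
  shows "(\<exists>M>0. M \<ge> Max {3 * k0 powr t * V 0 x0 y0, 3 / a * C2 M}) \<and>
         (\<forall>M>0. M \<ge> Max {3 * k0 powr t * V 0 x0 y0, 3 / a * C2 M} \<longrightarrow>
           (\<forall>k. integrable P (\<lambda>\<omega>. V k (X k \<omega>) (Y k \<omega>)) \<and>
                integral\<^sup>L P (\<lambda>\<omega>. V k (X k \<omega>) (Y k \<omega>)) \<le> M / (real k + k0) powr t))"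
proof -
  interpret prob_space P by (rule prob)
  interpret S: coupled_system f g lam ys L\<^sub>l L\<^sub>f L\<^sub>g \<mu>\<^sub>f \<mu>\<^sub>g
  proof
    have "xs = lam ys" using root lam_unique by blast
    then show "g (lam ys) ys = 0" using root by simp
  qed (use lam_root lam_lipschitz f_lipschitz g_lipschitz f_monotone g_monotone mu_f mu_g in blast)+
  note a_t = optimal_exponent[OF delta_range m_eq a_eq t_eq]
  have t0: "t > 0" using a_t(3) by simp
  have L0: "L\<^sub>l \<ge> 0" "L\<^sub>f \<ge> 0" "L\<^sub>g > 0" using S.L_nonneg S.Lf_nonneg S.Lg_pos by auto
  have c0: "c > 0" unfolding c_eq using L0 mu_f mu_g by simp
  define \<rho> where "\<rho> = \<beta> / \<alpha>"
  have \<rho>0: "\<rho> > 0" unfolding \<rho>_def using pos by simp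
  define D where "D = c * (2 / \<mu>\<^sub>f * L\<^sub>l\<^sup>2 + 2 / \<mu>\<^sub>f * L\<^sub>f\<^sup>2 * L\<^sub>l\<^sup>2 + 2 * L\<^sub>l\<^sup>2) + 1"
  have Cab: "Cab = L\<^sub>f\<^sup>2 + 4 * L\<^sub>l\<^sup>2 * L\<^sub>g\<^sup>2 * \<rho>\<^sup>2 + 2 * L\<^sub>f * L\<^sub>l * L\<^sub>g * \<rho>
        + 2 / \<mu>\<^sub>g * L\<^sub>f\<^sup>2 * L\<^sub>l\<^sup>2 * L\<^sub>g\<^sup>2 * (L\<^sub>l + 1)\<^sup>2 * \<beta>
        + 1 / c * L\<^sub>g\<^sup>2 * (L\<^sub>l + 2) * \<rho>
        + 4 * c * L\<^sub>l\<^sup>2 * L\<^sub>g\<^sup>2 * (L\<^sub>l + 1)\<^sup>2 * \<rho> ^ 3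
        + L\<^sub>g\<^sup>2 * (2 * L\<^sub>l\<^sup>2 + L\<^sub>l + 3) * \<rho>\<^sup>2"
    unfolding Cab_eq \<rho>_def by (simp add: power_divide)
  have Cab0: "Cab \<ge> 0"
    unfolding Cab using L0 c0 \<rho>0 mu_g pos
    by (intro add_nonneg_nonneg mult_nonneg_nonneg divide_nonneg_nonneg) auto
  have \<rho>le: "\<rho> * z \<le> 1" if "z \<le> \<alpha> / \<beta>" for z
    using mult_left_mono[OF that less_imp_le[OF \<rho>0]] pos unfolding \<rho>_def by simp
  have rat: "4 / \<mu>\<^sub>f * (2 * L\<^sub>l * L\<^sub>g + 2 / \<mu>\<^sub>g * L\<^sub>l\<^sup>2 * L\<^sub>g\<^sup>2 * (L\<^sub>l + 1)\<^sup>2) \<le> \<alpha> / \<beta>"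
    "2 * c \<le> \<alpha> / \<beta>" "\<mu>\<^sub>g / \<mu>\<^sub>f \<le> \<alpha> / \<beta>"
    using ratio by simp_all
  have k0: "\<alpha> powr (1 / a) \<le> k0" "(\<alpha>\<^sup>2 / \<beta>) powr (1 / (2 * a - 1)) \<le> k0"
    "1 / (2 powr (1 / t) - 1) \<le> k0" "(6 * Cab * \<alpha>\<^sup>2) powr (1 / (2 * a - 1)) \<le> k0"
    using k0_ge by simp_all
  define K where "K k = real k + 1 + k0" for k :: nat
  have K: "K k > 1" "k0 \<le> K k - 1" for k unfolding K_def using pos by auto
  have root_le: "z \<le> K k powr e" if "z powr (1 / e) \<le> k0" "z \<ge> 0" "e > 0" for z e k
  proof -
    have "z = (z powr (1 / e)) powr e" using that by (simp add: powr_powr)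
    also have "\<dots> \<le> K k powr e" using that K[of k] by (intro powr_mono2) auto
    finally show ?thesis .
  qed
  define r where "r k = \<beta>s k / \<alpha>s k" for k
  have As: "\<alpha>s k = \<alpha> * K k powr (- a)" and Bs: "\<beta>s k = \<beta> / K k" for k
    unfolding alpha_step[rule_format] beta_step[rule_format] K_def b_eq using pos
    by (simp_all add: powr_minus divide_inverse)
  have rs: "r k = \<rho> * K k powr (a - 1)" for k
    unfolding r_def As Bs \<rho>_def using K[of k] pos by (simp add: powr_diff powr_minus field_simps)
  have AB0: "\<alpha>s k > 0" "\<beta>s k > 0" "r k > 0" for k
    unfolding r_def As Bs using pos K[of k] by auto
  have r\<rho>: "r k \<le> \<rho>" for k
  proof -
    have "K k powr (a - 1) \<le> 1"
      using K[of k] a_t(2) powr_mono[of "a - 1" 0 "K k"] by simp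
    then show ?thesis unfolding rs using \<rho>0 mult_left_mono[of _ 1 \<rho>] by fastforce
  qed
  have r_decr: "r (Suc k) \<le> r k" for k
  proof -
    have "K (Suc k) powr (a - 1) \<le> K k powr (a - 1)"
      using K[of k] a_t(2) by (intro powr_mono2') (auto simp: K_def)
    then show ?thesis unfolding rs using \<rho>0 by (intro mult_left_mono) auto
  qed
  have rle: "r k * z \<le> 1" if "z \<le> \<alpha> / \<beta>" "z \<ge> 0" for k z
    using mult_right_mono[OF r\<rho> that(2)] \<rho>le[OF that(1)] by (rule order_trans)
  have A2: "(\<alpha>s k)\<^sup>2 = \<alpha>\<^sup>2 / (K k powr (2 * a - 1) * K k)" for k
  proof -
    have "K k powr (2 * a - 1) * K k = K k powr (2 * a)"
      using K[of k] by (simp add: powr_diff)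
    moreover have "(K k powr (- a))\<^sup>2 = 1 / K k powr (2 * a)"
      using K[of k] by (simp add: power2_eq_square powr_add[symmetric] powr_minus[symmetric] divide_inverse)
    ultimately show ?thesis unfolding As by (simp add: power_mult_distrib)
  qed
  have A1: "\<alpha>s k \<le> 1" for k
    using root_le[OF k0(1), of k] pos a_t(1) K[of k] unfolding As by (simp add: powr_minus field_simps)
  have AB: "(\<alpha>s k)\<^sup>2 \<le> \<beta>s k" for k
  proof -
    have "\<alpha>\<^sup>2 / \<beta> \<le> K k powr (2 * a - 1)"
      using root_le[OF k0(2), of k] pos a_t(1) by simp
    then show ?thesis unfolding A2 Bs using K[of k] pos by (simp add: field_simps)
  qed
  have CA: "Cab * (\<alpha>s k)\<^sup>2 \<le> 1 / (6 * K k)" for k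
  proof -
    have "6 * Cab * \<alpha>\<^sup>2 \<le> K k powr (2 * a - 1)"
      using root_le[OF k0(4), of k] Cab0 a_t(1) by simp
    then show ?thesis unfolding A2 using K[of k] by (simp add: field_simps)
  qed
  have B\<beta>: "\<beta>s k \<le> \<beta>" for k unfolding Bs using K[of k] pos by (simp add: field_simps)
  have drift_coeff: "1 - \<mu>\<^sub>g * \<beta>s k / 2 + Cab * (\<alpha>s k)\<^sup>2 \<le> 1 - (2 * a + t) / K k + 1 / (6 * K k)" for k
  proof -
    have "2 * a + t \<le> \<mu>\<^sub>g * \<beta> / 2" using beta_ge mu_g by (simp add: field_simps)
    then have "(2 * a + t) / K k \<le> \<mu>\<^sub>g * \<beta> / 2 / K k"
      using K[of k] by (intro divide_right_mono) auto
    then have "(2 * a + t) / K k \<le> \<mu>\<^sub>g * \<beta>s k / 2" unfolding Bs by simp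
    then show ?thesis using CA[of k] by linarith
  qed
  \<comment> \<open>The induction hypothesis at time \<open>k\<close> has the rate at \<open>K k - 1\<close>; passing to \<open>K k\<close> costs the
    factor 2 in front of \<open>M\<close> in \<open>C2\<close>.\<close>
  have doubling: "K k powr t \<le> 2 * (K k - 1) powr t" for k
  proof -
    have "2 powr (1 / t) > 1" using t0 by simp
    then have "1 \<le> (2 powr (1 / t) - 1) * k0" using k0(3) by (simp add: field_simps)
    also have "\<dots> \<le> (2 powr (1 / t) - 1) * (K k - 1)"
      using K[of k] \<open>2 powr (1 / t) > 1\<close> by (intro mult_left_mono) auto
    finally have "K k \<le> 2 powr (1 / t) * (K k - 1)" by (simp add: algebra_simps)
    then have "K k powr t \<le> (2 powr (1 / t) * (K k - 1)) powr t"
      using K[of k] t0 by (intro powr_mono2) auto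
    also have "\<dots> = 2 * (K k - 1) powr t" using t0 by (simp add: powr_mult powr_powr)
    finally show ?thesis .
  qed
  have V: "V k = S.lyap (c * r k)" for k
    unfolding V_eq r_def by (simp add: fun_eq_iff S.lyap_def)
  \<comment> \<open>The four inequalities between \<open>t\<close> and \<open>a\<close> make every noise contribution decay at least as
    fast as \<open>K k\<close> to the power \<open>-(1 + t)\<close>; \<open>R\<close> bounds the expected Lyapunov function at time \<open>k\<close>.\<close>
  have noise: "2 * c * \<alpha>s k * \<beta>s k * (\<Gamma>11 * (R / (c * r k)) powr \<delta>11 + \<Gamma>12 * R powr \<delta>12)
        + \<beta>s k ^ 3 / (\<alpha>s k)\<^sup>2 * D * (\<Gamma>21 * (R / (c * r k)) powr \<delta>21 + \<Gamma>22 * R powr \<delta>22)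
      \<le> C2 M / K k powr (1 + t)" if M: "M > 0" and R: "R = 2 * M * K k powr (- t)" for M R k
  proof -
    define zx where "zx = 1 / c * (\<alpha> / \<beta>) * (2 * M)"
    have zx0: "zx \<ge> 0" unfolding zx_def using c0 pos M by simp
    have Rx: "R / (c * r k) = zx * K k powr (1 - a - t)"
      unfolding R rs zx_def \<rho>_def using K[of k] c0 pos
      by (simp add: powr_diff powr_minus powr_add field_simps)
    have e1: "\<alpha>s k * \<beta>s k = \<alpha> * \<beta> * K k powr (- (1 + a))"
      unfolding As Bs using K[of k] by (simp add: powr_minus powr_diff field_simps)
    have e2: "\<beta>s k ^ 3 / (\<alpha>s k)\<^sup>2 = \<beta> ^ 3 / \<alpha>\<^sup>2 * K k powr (2 * a - 3)"
      unfolding A2 Bs using K[of k] pos by (simp add: powr_diff power3_eq_cube field_simps)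
    define J where "J = K k powr (- (1 + t))"
    have K1: "1 \<le> K k" using K[of k] by simp
    have j11: "K k powr (- (1 + a)) * (zx * K k powr (1 - a - t)) powr \<delta>11 \<le> zx powr \<delta>11 * J"
      unfolding J_def using a_t(4) by (intro powr_exponent_collect[OF K1 zx0]) (simp add: algebra_simps)
    have j12: "K k powr (- (1 + a)) * (2 * M * K k powr (- t)) powr \<delta>12 \<le> (2 * M) powr \<delta>12 * J"
      unfolding J_def using a_t(5) M by (intro powr_exponent_collect[OF K1]) (auto simp: algebra_simps)
    have j21: "K k powr (2 * a - 3) * (zx * K k powr (1 - a - t)) powr \<delta>21 \<le> zx powr \<delta>21 * J"
      unfolding J_def using a_t(6) by (intro powr_exponent_collect[OF K1 zx0]) (simp add: algebra_simps)
    have j22: "K k powr (2 * a - 3) * (2 * M * K k powr (- t)) powr \<delta>22 \<le> (2 * M) powr \<delta>22 * J"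
      unfolding J_def using a_t(7) M by (intro powr_exponent_collect[OF K1]) (auto simp: algebra_simps)
    have D0: "D \<ge> 0" unfolding D_def using c0 mu_f by simp
    have "2 * c * \<alpha>s k * \<beta>s k * (\<Gamma>11 * (R / (c * r k)) powr \<delta>11 + \<Gamma>12 * R powr \<delta>12)
        + \<beta>s k ^ 3 / (\<alpha>s k)\<^sup>2 * D * (\<Gamma>21 * (R / (c * r k)) powr \<delta>21 + \<Gamma>22 * R powr \<delta>22)
      = 2 * c * \<alpha> * \<beta> * \<Gamma>11 * (K k powr (- (1 + a)) * (zx * K k powr (1 - a - t)) powr \<delta>11)
        + 2 * c * \<alpha> * \<beta> * \<Gamma>12 * (K k powr (- (1 + a)) * (2 * M * K k powr (- t)) powr \<delta>12)
        + \<beta> ^ 3 / \<alpha>\<^sup>2 * D * \<Gamma>21 * (K k powr (2 * a - 3) * (zx * K k powr (1 - a - t)) powr \<delta>21)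
        + \<beta> ^ 3 / \<alpha>\<^sup>2 * D * \<Gamma>22 * (K k powr (2 * a - 3) * (2 * M * K k powr (- t)) powr \<delta>22)"
      unfolding Rx e2 mult.assoc[of "2 * c" "\<alpha>s k"] e1 unfolding R by (simp only: distrib_left ac_simps)
    also have "\<dots> \<le> 2 * c * \<alpha> * \<beta> * \<Gamma>11 * (zx powr \<delta>11 * J) + 2 * c * \<alpha> * \<beta> * \<Gamma>12 * ((2 * M) powr \<delta>12 * J)
        + \<beta> ^ 3 / \<alpha>\<^sup>2 * D * \<Gamma>21 * (zx powr \<delta>21 * J) + \<beta> ^ 3 / \<alpha>\<^sup>2 * D * \<Gamma>22 * ((2 * M) powr \<delta>22 * J)"
      using c0 pos D0 Gamma_nonneg by (intro add_mono mult_left_mono j11 j12 j21 j22) auto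
    also have "\<dots> = C2 M * J"
      unfolding C2_eq zx_def D_def by (simp only: distrib_left distrib_right ac_simps)
    finally show ?thesis unfolding J_def powr_minus divide_inverse .
  qed
  have [measurable]: "\<xi> k \<in> borel_measurable P" "\<psi> k \<in> borel_measurable P" for k
    using noise_measurable by auto
  have X0[measurable]: "X 0 \<in> borel_measurable P" and Y0[measurable]: "Y 0 \<in> borel_measurable P"
  proof -
    show "X 0 \<in> borel_measurable P" by (subst measurable_cong[where g = "\<lambda>_. x0"]) (use init in auto)
    show "Y 0 \<in> borel_measurable P" by (subst measurable_cong[where g = "\<lambda>_. y0"]) (use init in auto)
  qed
  define F where "F = history P (X 0) (Y 0) \<xi> \<psi>"
  have sub: "subalgebra P (F n)" for n unfolding F_def by (rule history_generators) measurable
  have spF: "space (F n) = space P" for n using sub[of n] by (simp add: subalgebra_def)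
  have \<xi>F: "\<xi> i \<in> borel_measurable (F n)" and \<psi>F: "\<psi> i \<in> borel_measurable (F n)" if "i < n" for i n
    unfolding F_def using that by (auto intro!: history_generators)
  have XY: "X k \<in> borel_measurable (F n) \<and> Y k \<in> borel_measurable (F n)" if "k \<le> n" for k n
    using that
  proof (induction k)
    case 0
    show ?case unfolding F_def by (auto intro!: history_generators)
  next
    case (Suc k)
    then have [measurable]: "X k \<in> borel_measurable (F n)" "Y k \<in> borel_measurable (F n)"
      "\<xi> k \<in> borel_measurable (F n)" "\<psi> k \<in> borel_measurable (F n)"
      using \<xi>F \<psi>F by auto
    have [measurable]: "(\<lambda>\<omega>. f (X k \<omega>) (Y k \<omega>)) \<in> borel_measurable (F n)"
      "(\<lambda>\<omega>. g (X k \<omega>) (Y k \<omega>)) \<in> borel_measurable (F n)"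
      by (auto intro!: S.f_measurable S.g_measurable)
    have "X (Suc k) \<in> borel_measurable (F n)"
      by (subst measurable_cong[where g = "\<lambda>\<omega>. X k \<omega> - \<alpha>s k *\<^sub>R (f (X k \<omega>) (Y k \<omega>) + \<xi> k \<omega>)"])
         (use X_step spF in auto)
    moreover have "Y (Suc k) \<in> borel_measurable (F n)"
      by (subst measurable_cong[where g = "\<lambda>\<omega>. Y k \<omega> - \<beta>s k *\<^sub>R (g (X k \<omega>) (Y k \<omega>) + \<psi> k \<omega>)"])
         (use Y_step spF in auto)
    ultimately show ?case ..
  qed
  have bound: "integrable P (\<lambda>\<omega>. V k (X k \<omega>) (Y k \<omega>)) \<and>
      (\<integral>\<omega>. V k (X k \<omega>) (Y k \<omega>) \<partial>P) \<le> M / (K k - 1) powr t"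
    if M: "M > 0" "M \<ge> 3 * k0 powr t * V 0 x0 y0" "M \<ge> 3 / a * C2 M" for M k
  proof (induction k)
    case 0
    have V0: "V 0 (X 0 \<omega>) (Y 0 \<omega>) = V 0 x0 y0" if "\<omega> \<in> space P" for \<omega> using init that by simp
    have "integrable P (\<lambda>\<omega>. V 0 (X 0 \<omega>) (Y 0 \<omega>))"
      by (subst Bochner_Integration.integrable_cong[OF refl V0]) auto
    moreover have "(\<integral>\<omega>. V 0 (X 0 \<omega>) (Y 0 \<omega>) \<partial>P) = V 0 x0 y0"
      by (subst Bochner_Integration.integral_cong[OF refl V0]) (auto simp: prob_space)
    moreover have "V 0 x0 y0 \<le> M / (K 0 - 1) powr t"
    proof -
      have "0 \<le> k0 powr t * V 0 x0 y0"
        unfolding V S.lyap_def using c0 AB0(3)[of 0] by (intro mult_nonneg_nonneg add_nonneg_nonneg) auto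
      then have "k0 powr t * V 0 x0 y0 \<le> M" using M(2) by simp
      then show ?thesis unfolding K_def using pos by (simp add: field_simps)
    qed
    ultimately show ?case by simp
  next
    case (Suc k)
    define R where "R = 2 * M * K k powr (- t)"
    have R0: "R > 0" unfolding R_def using M K[of k] by simp
    define E where "E = (\<integral>\<omega>. S.lyap (c * r k) (X k \<omega>) (Y k \<omega>) \<partial>P)"
    have int: "integrable P (\<lambda>\<omega>. S.lyap (c * r k) (X k \<omega>) (Y k \<omega>))"
      and E: "E \<le> M / (K k - 1) powr t"
      using Suc unfolding V E_def by auto
    have "M / (K k - 1) powr t \<le> R"
    proof -
      have "M * K k powr t \<le> M * (2 * (K k - 1) powr t)" using doubling M by (intro mult_left_mono) auto
      then show ?thesis unfolding R_def using K[of k] pos by (simp add: powr_minus field_simps)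
    qed
    with E have ER: "(\<integral>\<omega>. S.lyap (c * r k) (X k \<omega>) (Y k \<omega>) \<partial>P) \<le> R" unfolding E_def by simp
    have E0: "E \<ge> 0" unfolding E_def S.lyap_def using c0 AB0(3)[of k] by (intro Bochner_Integration.integral_nonneg) auto
    have var: "AE \<omega> in P. nn_cond_exp P (F k) (\<lambda>w. ennreal ((norm (\<xi> k w))\<^sup>2)) \<omega>
         \<le> ennreal (\<Gamma>11 * rpow (norm (X k \<omega> - lam (Y k \<omega>))) (2 * \<delta>11)
                    + \<Gamma>12 * rpow (norm (Y k \<omega> - ys)) (2 * \<delta>12))"
      "AE \<omega> in P. nn_cond_exp P (F k) (\<lambda>w. ennreal ((norm (\<psi> k w))\<^sup>2)) \<omega>
         \<le> ennreal (\<Gamma>21 * rpow (norm (X k \<omega> - lam (Y k \<omega>))) (2 * \<delta>21)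
                    + \<Gamma>22 * rpow (norm (Y k \<omega> - ys)) (2 * \<delta>22))"
      using noise_second_moment unfolding F_def by (auto elim: eventually_mono)
    have rz: "r k * (4 / \<mu>\<^sub>f * (2 * L\<^sub>l * L\<^sub>g + 2 / \<mu>\<^sub>g * L\<^sub>l\<^sup>2 * L\<^sub>g\<^sup>2 * (L\<^sub>l + 1)\<^sup>2)) \<le> 1"
      using rat(1) L0 mu_f mu_g by (intro rle) auto
    have rc: "r k * (2 * c) \<le> 1" using rat(2) c0 by (intro rle) auto
    have rm: "r k * \<mu>\<^sub>g \<le> \<mu>\<^sub>f"
      using rle[OF rat(3), of k] mu_f mu_g by (simp add: field_simps)
    have XF: "X k \<in> borel_measurable (F k)" and YF: "Y k \<in> borel_measurable (F k)" using XY[of k k] by auto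
    note step = S.expected_drift[OF D_def prob sub[of k] XF YF
        noise_measurable(1)[rule_format, of k] noise_measurable(2)[rule_format, of k]
        X_step[rule_format, of _ k] Y_step[rule_format, of _ k]
        noise_mean(1)[rule_format, of k, folded F_def] noise_mean(2)[rule_format, of k, folded F_def]
        var Gamma_nonneg delta_range AB0(1,2)[of k] c_eq r_def[of k] A1[of k] AB[of k] B\<beta>[of k] r\<rho>[of k]
        rz rc rm Cab int ER R0]
    have int': "integrable P (\<lambda>\<omega>. S.lyap (c * r k) (X (Suc k) \<omega>) (Y (Suc k) \<omega>))"
      by (rule step(1))
    have "(\<integral>\<omega>. S.lyap (c * r k) (X (Suc k) \<omega>) (Y (Suc k) \<omega>) \<partial>P)
        \<le> (1 - \<mu>\<^sub>g * \<beta>s k / 2 + Cab * (\<alpha>s k)\<^sup>2) * E + C2 M / K k powr (1 + t)"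
      using step(2) noise[OF M(1) R_def] unfolding E_def by linarith
    also have "\<dots> \<le> M / K k powr t"
    proof (rule rate_step[OF K(1) a_t(3,1,2) M(1) drift_coeff E0 E])
      have "C2 M \<le> a / 3 * M" using M(3) a_t(1) by (simp add: field_simps)
      then show "C2 M / K k powr (1 + t) \<le> a / 3 * M / K k powr (1 + t)"
        by (intro divide_right_mono) auto
    qed
    finally have le: "(\<integral>\<omega>. S.lyap (c * r k) (X (Suc k) \<omega>) (Y (Suc k) \<omega>) \<partial>P) \<le> M / K k powr t" .
    \<comment> \<open>The one-step bound keeps the weight of time \<open>k\<close>; the weight of time \<open>k + 1\<close> is smaller.\<close>
    have mono: "S.lyap (c * r (Suc k)) x y \<le> S.lyap (c * r k) x y" for x y
      unfolding S.lyap_def using c0 r_decr by (intro add_right_mono mult_right_mono mult_left_mono) auto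
    have nonneg: "0 \<le> S.lyap (c * r (Suc k)) x y" for x y
      unfolding S.lyap_def using c0 AB0(3)[of "Suc k"] by simp
    have XYP: "X (Suc k) \<in> borel_measurable P" "Y (Suc k) \<in> borel_measurable P"
      using XY[of "Suc k" "Suc k"] measurable_from_subalg[OF sub] by auto
    have "integrable P (\<lambda>\<omega>. S.lyap (c * r (Suc k)) (X (Suc k) \<omega>) (Y (Suc k) \<omega>))"
      using mono nonneg
      by (intro Bochner_Integration.integrable_bound[OF int' S.lyap_measurable[OF XYP]] AE_I2)
         (simp add: order_trans[OF _ abs_ge_self])
    moreover from this have "(\<integral>\<omega>. S.lyap (c * r (Suc k)) (X (Suc k) \<omega>) (Y (Suc k) \<omega>) \<partial>P)
        \<le> (\<integral>\<omega>. S.lyap (c * r k) (X (Suc k) \<omega>) (Y (Suc k) \<omega>) \<partial>P)"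
      using int' mono by (intro Bochner_Integration.integral_mono)
    moreover have "K (Suc k) - 1 = K k" by (simp add: K_def)
    ultimately show ?case unfolding V using le by simp
  qed
  have K1: "K k - 1 = real k + k0" for k by (simp add: K_def)
  have "\<exists>M>0. M \<ge> 3 * k0 powr t * V 0 x0 y0 \<and> M \<ge> 3 / a * C2 M"
  proof -
    let ?w = "1 / c * (\<alpha> / \<beta>)"
    have "\<exists>M>0. M \<ge> 3 * k0 powr t * V 0 x0 y0 \<and>
      M \<ge> 3 / a * (2 * c * \<alpha> * \<beta> * \<Gamma>11 * (2 * ?w) powr \<delta>11) * M powr \<delta>11
        + 3 / a * (2 * c * \<alpha> * \<beta> * \<Gamma>12 * 2 powr \<delta>12) * M powr \<delta>12
        + 3 / a * (\<beta> ^ 3 / \<alpha>\<^sup>2 * D * \<Gamma>21 * (2 * ?w) powr \<delta>21) * M powr \<delta>21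
        + 3 / a * (\<beta> ^ 3 / \<alpha>\<^sup>2 * D * \<Gamma>22 * 2 powr \<delta>22) * M powr \<delta>22"
      using delta_range by (intro exists_dominating_powr_sum) auto
    moreover have "3 / a * C2 M = 3 / a * (2 * c * \<alpha> * \<beta> * \<Gamma>11 * (2 * ?w) powr \<delta>11) * M powr \<delta>11
        + 3 / a * (2 * c * \<alpha> * \<beta> * \<Gamma>12 * 2 powr \<delta>12) * M powr \<delta>12
        + 3 / a * (\<beta> ^ 3 / \<alpha>\<^sup>2 * D * \<Gamma>21 * (2 * ?w) powr \<delta>21) * M powr \<delta>21
        + 3 / a * (\<beta> ^ 3 / \<alpha>\<^sup>2 * D * \<Gamma>22 * 2 powr \<delta>22) * M powr \<delta>22" if "M > 0" for M
    proof -
      have p: "(?w * (2 * M)) powr d = (2 * ?w) powr d * M powr d" "(2 * M) powr d = 2 powr d * M powr d" for d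
        using that c0 pos powr_mult[of "2 * ?w" M d] by (simp_all add: powr_mult ac_simps)
      show ?thesis unfolding C2_eq p D_def[symmetric] by (simp only: distrib_left ac_simps)
    qed
    ultimately show ?thesis by metis
  qed
  then show ?thesis using bound unfolding K1 by auto
qed

end
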